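(* Consider the DISFOM algorithm with distance term $\phi(\mathbf{z})=\frac{\hat\rho}{2}\|\mathbf{z}\|_1^2$ and the variance-reduced gradient estimate $G^k$ with parameters $q,m,m_1$, as described in the context, under assumptions (A1)-(A4). Let $\epsilon>0$ and choose $$\eta=\frac1L,\quad K=\left\lceil\frac{\Delta L}{\epsilon^2}\right\rceil,\quad m_1=\left\lceil\frac{c(\log d)\sigma_\infty^2}{\epsilon^2}\right\rceil,\quad m=q^2=\left\lceil\left(\frac{c(\log d)\sigma_\infty^2}{\epsilon^2}\right)^{1/3}\right\rceil^2,\quad \hat\epsilon=\frac{\epsilon}{L},\quad\hat\rho=128$$ (the auxiliary constants of the analysis, which do not enter the algorithm, being $\gamma=\frac12$, $\tau=t=\frac1{64L}$). Then $$\mathbb{E}\big[\mathrm{dist}_{\|\cdot\|_\infty}(0,\partial(f+\delta_X)(\mathbf{x}^{Y+1}))\big]\le C\epsilon ,$$ where $C$ is an absolute constant independent of any parameter of the algorithm or the problem data. Moreover, the sample complexity (total number of samples of $\zeta$ used) is upper bounded by $$Km+\left\lceil\frac Kq\right\rceil m_1\le 2K(m+q^2)=4\left\lceil\frac{\Delta L}{\epsilon^2}\right\rceil\left\lceil\left(\frac{c(\log d)\sigma_\infty^2}{\epsilon^2}\right)^{1/3}\right\rceil^2=\mathcal{O}\left(\frac{\Delta L\,(c(\log d)\sigma_\infty^2)^{2/3}}{\epsilon^{10/3}}\right).$$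
   Context: Problem: minimize $f(\mathbf{x})=\mathbb{E}[F(\mathbf{x},\zeta)]$ over a nonempty closed convex set $X\subseteq\mathbb{R}^d$, $d\ge2$, where $\zeta$ is a random vector, $F(\cdot,\zeta)$ and $f$ are real-valued and differentiable on $\mathbb{R}^d$ ($f$ possibly nonconvex). $\|\cdot\|$ is the Euclidean norm. Assumptions. (A1) A stochastic first-order oracle returns $\nabla F(\mathbf{x},\zeta)$ for any input $(\mathbf{x},\zeta)$. (A2) With $w(\mathbf{x})=\nabla F(\mathbf{x},\zeta)-\nabla f(\mathbf{x})$: $\mathbb{E}[w(\mathbf{x})]=0$ and $\mathbb{E}[\exp(t\,w_i(\mathbf{x}))]\le\exp(\sigma_\infty^2t^2/2)$ for all $t\in\mathbb{R}$, $i=1,\dots,d$, $\mathbf{x}\in X$. (A3) $\|\nabla F(\mathbf{x},\zeta)-\nabla F(\mathbf{y},\zeta)\|\le L\|\mathbf{x}-\mathbf{y}\|$ for all $\mathbf{x},\mathbf{y}\in X$ and all $\zeta$, with $L>0$. (A4) $f(\mathbf{x})\ge\underline f$ for all $\mathbf{x}\in X$. Algorithm (DISFOM). Given an integer $K\ge1$, stepsize $\eta>0$, tolerance $\hat\epsilon\ge0$, and a (possibly random) $\mathbf{x}^1\in X$ with $\mathbb{E}[f(\mathbf{x}^1)]$ finite, for $k=1,\dots,K$: form a gradient estimate $G^k$, and compute $\mathbf{x}^{k+1}\in X$ as an approximate solution of $\min_{\mathbf{x}\in X}\frac12\|\mathbf{x}-(\mathbf{x}^k-\eta G^k)\|^2+\phi(\mathbf{x}-\mathbf{x}^k)$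 in the sense that there exist $\xi^{k+1},\Gamma^{k+1},\mathbf{y}^{k+1}\in\mathbb{R}^d$ with $(\mathbf{x}^{k+1}-\mathbf{x}^k+\eta G^k+\xi^{k+1}+\Gamma^{k+1})^T(\mathbf{x}-\mathbf{x}^{k+1})\ge0$ for all $\mathbf{x}\in X$; $\xi^{k+1}\in\partial\phi(\mathbf{y}^{k+1}-\mathbf{x}^k)$; $\|\Gamma^{k+1}\|\le\hat\epsilon$; $\|\mathbf{x}^{k+1}-\mathbf{y}^{k+1}\|_1\le\hat\epsilon$. Output $\mathbf{x}^{Y+1}$ with $Y$ uniform on $\{1,\dots,K\}$, independent of everything else. Variance-reduced estimate. Given positive integers $q,m,m_1$, let $n_k=\lfloor\frac{k-1}{q}\rfloor q+1$. If $k=n_k$ (the first iteration of each block of $q$ iterations), $G^k=\frac1{m_1}\sum_{i=1}^{m_1}\nabla F(\mathbf{x}^k,\zeta_i^k)$; otherwise $G^k=\frac1m\sum_{i=1}^m\big(\nabla F(\mathbf{x}^k,\zeta_i^k)-\nabla F(\mathbf{x}^{n_k},\zeta_i^k)\big)+G^{n_k}$. The samples $\zeta_i^k$ are i.i.d. copies of $\zeta$, those drawn at iteration $k$ being independent of $\mathbf{x}^1,\dots,\mathbf{x}^k$. Notation: $\Delta=\mathbb{E}[f(\mathbf{x}^1)]-\underline f$; $\delta_X$ is the indicator function of $X$; $\partial(f+\delta_X)(\mathbf{x})=\nabla f(\mathbf{x})+N_X(\mathbf{x})$ for $\mathbf{x}\in X$, with $N_X$ the normal cone; $\mathrm{dist}_{\|\cdot\|_\infty}(0,S)=\inf\{\|\mathbf{v}\|_\infty:\mathbf{v}\in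 S\}$. $c>0$ is an absolute constant such that, for every $d\ge2$ and $m\ge1$, the average $\bar w$ of $m$ i.i.d. mean-zero random vectors in $\mathbb{R}^d$ whose components satisfy the sub-Gaussian bound in (A2) satisfies $\mathbb{E}\|\bar w\|_\infty^2\le c(\log d)\sigma_\infty^2/m$ (such a $c$ exists, e.g. $c=12$). $\Delta$ and $\sigma_\infty$ are positive. $\mathcal{O}(\cdot)$ hides absolute constants.
   Formalization: The inequality Km+⌈K/q⌉m_1 ≤ 2K(m+q²), false e.g. for K=1, q=100, m_1=10^6, is proved for q ≤ 3K, and the O-bound (constant 32) for ε² ≤ ΔL and ε² ≤ c(log d)σ_∞²; these conditions are proved to hold for all sufficiently small ε. *)

theory Defs
  imports "HOL-Probability.Probability"
begin

section \<open>Deterministic notions\<close>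

definition l1norm :: "real ^ 'd \<Rightarrow> real" where
  "l1norm x = (\<Sum>i\<in>UNIV. \<bar>x $ i\<bar>)"

text \<open>The $\ell_\infty$ norm is the library's \<^const>\<open>infnorm\<close>.\<close>

definition gradient :: "('a::real_inner \<Rightarrow> real) \<Rightarrow> 'a \<Rightarrow> 'a" where
  "gradient f x = (THE g. GDERIV f x :> g)"

definition subdifferential :: "('a::real_inner \<Rightarrow> real) \<Rightarrow> 'a \<Rightarrow> 'a set" where
  "subdifferential \<phi> z = {\<xi>. \<forall>u. \<phi> u \<ge> \<phi> z + \<xi> \<bullet> (u - z)}"

definition normal_cone :: "'a::real_inner set \<Rightarrow> 'a \<Rightarrow> 'a set" where
  "normal_cone X x = {v. x \<in> X \<and> (\<forall>y\<in>X. v \<bullet> (y - x) \<le> 0)}"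

text \<open>The set $\partial(f+\delta_X)(x) = \nabla f(x) + N_X(x)$ for $f$ differentiable.\<close>

definition constrained_subdiff :: "('a::real_inner \<Rightarrow> real) \<Rightarrow> 'a set \<Rightarrow> 'a \<Rightarrow> 'a set" where
  "constrained_subdiff f X x = (\<lambda>v. gradient f x + v) ` normal_cone X x"

text \<open>This is a real infimum, hence junk on the empty set; \<^term>\<open>constrained_subdiff f X x\<close>
  contains \<^term>\<open>gradient f x\<close> whenever \<^prop>\<open>x \<in> X\<close>.\<close>

definition dist_inf_zero :: "(real ^ 'd) set \<Rightarrow> real" where
  "dist_inf_zero S = (INF v\<in>S. infnorm v)"

definition dist_term :: "real \<Rightarrow> real ^ 'd \<Rightarrow> real" where
  "dist_term \<rho> z = \<rho> / 2 * (l1norm z)\<^sup>2"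

text \<open>\<^term>\<open>x'\<close> approximately solves
  $\min_{u\in X} \frac12\|u-(x-\eta g)\|^2+\phi(u-x)$ with tolerance \<^term>\<open>\<epsilon>h\<close>.\<close>

definition inexact_prox_step ::
  "(real ^ 'd) set \<Rightarrow> (real ^ 'd \<Rightarrow> real) \<Rightarrow> real \<Rightarrow> real \<Rightarrow> real ^ 'd \<Rightarrow> real ^ 'd \<Rightarrow> real ^ 'd \<Rightarrow> bool" where
  "inexact_prox_step X \<phi> \<eta> \<epsilon>h x g x' \<longleftrightarrow>
     x' \<in> X \<and>
     (\<exists>\<xi> \<Gamma> y.
        (\<forall>u\<in>X. (x' - x + \<eta> *\<^sub>R g + \<xi> + \<Gamma>) \<bullet> (u - x') \<ge> 0) \<and>
        \<xi> \<in> subdifferential \<phi> (y - x) \<and>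
        norm \<Gamma> \<le> \<epsilon>h \<and>
        l1norm (x' - y) \<le> \<epsilon>h)"


section \<open>The stochastic problem\<close>

text \<open>The library's \<^const>\<open>prob_space.indep_var\<close> forces both variables to have the same value type.\<close>

definition indep_rv ::
  "'w measure \<Rightarrow> 'a measure \<Rightarrow> ('w \<Rightarrow> 'a) \<Rightarrow> 'b measure \<Rightarrow> ('w \<Rightarrow> 'b) \<Rightarrow> bool" where
  "indep_rv M S U T V \<longleftrightarrow>
     U \<in> measurable M S \<and> V \<in> measurable M T \<and>
     prob_space.indep_set M {U -` B \<inter> space M |B. B \<in> sets S} {V -` B \<inter> space M |B. B \<in> sets T}"

definition subgaussian_components :: "'a measure \<Rightarrow> ('a \<Rightarrow> real ^ 'd) \<Rightarrow> real \<Rightarrow> bool" where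
  "subgaussian_components N W \<sigma> \<longleftrightarrow>
     (\<forall>t i. integrable N (\<lambda>\<omega>. exp (t * W \<omega> $ i)) \<and>
            (\<integral>\<omega>. exp (t * W \<omega> $ i) \<partial>N) \<le> exp (\<sigma>\<^sup>2 * t\<^sup>2 / 2))"

definition objective :: "'z measure \<Rightarrow> (real ^ 'd \<Rightarrow> 'z \<Rightarrow> real) \<Rightarrow> real ^ 'd \<Rightarrow> real" where
  "objective D F x = (\<integral>z. F x z \<partial>D)"

definition grad_sample :: "(real ^ 'd \<Rightarrow> 'z \<Rightarrow> real) \<Rightarrow> real ^ 'd \<Rightarrow> 'z \<Rightarrow> real ^ 'd" where
  "grad_sample F x z = gradient (\<lambda>u. F u z) x"

text \<open>\<^term>\<open>D\<close> is the distribution of the random vector $\zeta$, and \<^term>\<open>space D\<close> the set of its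
  possible values.\<close>

locale stochastic_problem = D: prob_space D
  for D :: "'z measure" +
  fixes F :: "real ^ 'd \<Rightarrow> 'z \<Rightarrow> real"
    and X :: "(real ^ 'd) set"
    and L \<sigma> f_low :: real
  assumes X_nonempty: "X \<noteq> {}"
    and X_closed: "closed X"
    and X_convex: "convex X"
    and F_integrable: "\<And>x. integrable D (F x)"
    and F_differentiable: "\<And>x z. z \<in> space D \<Longrightarrow> (\<lambda>u. F u z) differentiable (at x)"
    and f_differentiable: "\<And>x. objective D F differentiable (at x)"
    and noise_mean_zero: "\<And>x. x \<in> X \<Longrightarrow>
          has_bochner_integral D (\<lambda>z. grad_sample F x z - gradient (objective D F) x) 0"
    and noise_subgaussian: "\<And>x. x \<in> X \<Longrightarrow>
          subgaussian_components D (\<lambda>z. grad_sample F x z - gradient (objective D F) x) \<sigma>"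
    and L_pos: "L > 0"
    and \<sigma>_pos: "\<sigma> > 0"
    and grad_Lipschitz: "\<And>x y z. x \<in> X \<Longrightarrow> y \<in> X \<Longrightarrow> z \<in> space D \<Longrightarrow>
          norm (grad_sample F x z - grad_sample F y z) \<le> L * norm (x - y)"
    and f_bounded_below: "\<And>x. x \<in> X \<Longrightarrow> f_low \<le> objective D F x"


section \<open>The algorithm with the variance-reduced gradient estimate\<close>

definition block_start :: "nat \<Rightarrow> nat \<Rightarrow> nat" where
  "block_start q k = ((k - 1) div q) * q + 1"

definition batch_size :: "nat \<Rightarrow> nat \<Rightarrow> nat \<Rightarrow> nat \<Rightarrow> nat" where
  "batch_size q m m1 k = (if k = block_start q k then m1 else m)"

text \<open>The pairs \<^term>\<open>(k, i)\<close> for which a sample $\zeta_i^k$ is drawn.\<close>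

definition sample_index :: "nat \<Rightarrow> nat \<Rightarrow> nat \<Rightarrow> nat \<Rightarrow> (nat \<times> nat) set" where
  "sample_index K q m m1 = (SIGMA k:{1..K}. {1..batch_size q m m1 k})"

text \<open>A run on the sample space \<^term>\<open>M\<close>. The vectors $\xi,\Gamma,y$ certifying an inexact step
  may depend on the outcome in an arbitrary, possibly non-measurable, way.\<close>

locale disfom_vr_run =
  stochastic_problem D F X L \<sigma> f_low + P: prob_space M
  for D :: "'z measure" and F :: "real ^ 'd \<Rightarrow> 'z \<Rightarrow> real" and X :: "(real ^ 'd) set"
    and L \<sigma> f_low :: real and M :: "'w measure" +
  fixes \<phi> :: "real ^ 'd \<Rightarrow> real"
    and \<eta> \<epsilon>h :: real
    and K q m m1 :: nat
    and \<zeta> :: "nat \<Rightarrow> nat \<Rightarrow> 'w \<Rightarrow> 'z"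
    and x G :: "nat \<Rightarrow> 'w \<Rightarrow> real ^ 'd"
    and Y :: "'w \<Rightarrow> nat"
  assumes params_pos: "K \<ge> 1" "q \<ge> 1" "m \<ge> 1" "m1 \<ge> 1" "\<eta> > 0" "\<epsilon>h \<ge> 0"
    and x_measurable: "\<And>k. k \<in> {1..K + 1} \<Longrightarrow> x k \<in> borel_measurable M"
    and x1_in_X: "\<And>\<omega>. \<omega> \<in> space M \<Longrightarrow> x 1 \<omega> \<in> X"
    and f_x1_integrable: "integrable M (\<lambda>\<omega>. objective D F (x 1 \<omega>))"
    and samples_distr: "\<And>k i. (k, i) \<in> sample_index K q m m1 \<Longrightarrow> distr M D (\<zeta> k i) = D"
    and samples_indep: "P.indep_vars (\<lambda>_. D) (\<lambda>(k, i). \<zeta> k i) (sample_index K q m m1)"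
    and samples_indep_past: "\<And>k. k \<in> {1..K} \<Longrightarrow>
          indep_rv M
            (\<Pi>\<^sub>M i\<in>{1..batch_size q m m1 k}. D) (\<lambda>\<omega>. \<lambda>i\<in>{1..batch_size q m m1 k}. \<zeta> k i \<omega>)
            (\<Pi>\<^sub>M j\<in>{1..k}. borel) (\<lambda>\<omega>. \<lambda>j\<in>{1..k}. x j \<omega>)"
    and G_block_start: "\<And>k \<omega>. k \<in> {1..K} \<Longrightarrow> \<omega> \<in> space M \<Longrightarrow> k = block_start q k \<Longrightarrow>
          G k \<omega> = (1 / real m1) *\<^sub>R (\<Sum>i=1..m1. grad_sample F (x k \<omega>) (\<zeta> k i \<omega>))"
    and G_in_block: "\<And>k \<omega>. k \<in> {1..K} \<Longrightarrow> \<omega> \<in> space M \<Longrightarrow> k \<noteq> block_start q k \<Longrightarrow>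
          G k \<omega> = (1 / real m) *\<^sub>R (\<Sum>i=1..m. grad_sample F (x k \<omega>) (\<zeta> k i \<omega>)
                                          - grad_sample F (x (block_start q k) \<omega>) (\<zeta> k i \<omega>))
                   + G (block_start q k) \<omega>"
    and step: "\<And>k \<omega>. k \<in> {1..K} \<Longrightarrow> \<omega> \<in> space M \<Longrightarrow>
          inexact_prox_step X \<phi> \<eta> \<epsilon>h (x k \<omega>) (G k \<omega>) (x (k + 1) \<omega>)"
    and Y_uniform: "Y \<in> measurable M (count_space {1..K})"
          "\<And>k. k \<in> {1..K} \<Longrightarrow> P.prob {\<omega> \<in> space M. Y \<omega> = k} = 1 / real K"
    and Y_indep: "indep_rv M
          (count_space {1..K}) Y
          ((\<Pi>\<^sub>M j\<in>{1..K + 1}. borel) \<Otimes>\<^sub>M (\<Pi>\<^sub>M p\<in>sample_index K q m m1. D))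
          (\<lambda>\<omega>. (\<lambda>j\<in>{1..K + 1}. x j \<omega>, \<lambda>p\<in>sample_index K q m m1. \<zeta> (fst p) (snd p) \<omega>))"


section \<open>Constants\<close>

text \<open>The constant \<^term>\<open>c\<close> in $\mathbb{E}\|\bar w\|_\infty^2 \le c(\log d)\sigma^2/n$, for averages
  of i.i.d. vectors on probability spaces over the type \<^typ>\<open>'w\<close>, in dimension
  $d$ = \<^term>\<open>CARD('d)\<close>. An absolute \<^term>\<open>c\<close> satisfies this for all types at once.\<close>

definition averaging_constant :: "'w itself \<Rightarrow> 'd::finite itself \<Rightarrow> real \<Rightarrow> bool" where
  "averaging_constant _ _ c \<longleftrightarrow>
     (\<forall>(N :: 'w measure) (W :: nat \<Rightarrow> 'w \<Rightarrow> real ^ 'd) (n :: nat) (s :: real).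
        prob_space N \<and> n \<ge> 1 \<and> s > 0 \<and>
        prob_space.indep_vars N (\<lambda>_. borel) W {1..n} \<and>
        (\<forall>i\<in>{1..n}. distr N borel (W i) = distr N borel (W 1)) \<and>
        (\<forall>i\<in>{1..n}. has_bochner_integral N (W i) 0) \<and>
        (\<forall>i\<in>{1..n}. subgaussian_components N (W i) s) \<longrightarrow>
        integrable N (\<lambda>\<omega>. (infnorm ((1 / real n) *\<^sub>R (\<Sum>i=1..n. W i \<omega>)))\<^sup>2) \<and>
        (\<integral>\<omega>. (infnorm ((1 / real n) *\<^sub>R (\<Sum>i=1..n. W i \<omega>)))\<^sup>2 \<partial>N)
          \<le> c * ln (real CARD('d)) * s\<^sup>2 / real n)"

text \<open>Parameter choices as functions of the accuracy \<^term>\<open>\<epsilon>\<close>; the argument \<^term>\<open>A\<close> stands for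
  $c(\log d)\sigma^2$.\<close>

definition K_choice :: "real \<Rightarrow> real \<Rightarrow> real \<Rightarrow> nat" where
  "K_choice \<Delta> L \<epsilon> = nat \<lceil>\<Delta> * L / \<epsilon>\<^sup>2\<rceil>"

definition m1_choice :: "real \<Rightarrow> real \<Rightarrow> nat" where
  "m1_choice A \<epsilon> = nat \<lceil>A / \<epsilon>\<^sup>2\<rceil>"

definition q_choice :: "real \<Rightarrow> real \<Rightarrow> nat" where
  "q_choice A \<epsilon> = nat \<lceil>(A / \<epsilon>\<^sup>2) powr (1/3)\<rceil>"

text \<open>The absolute constants hidden in the error bound and in the $O(\cdot)$. They are numerals
  because the dimension and the underlying spaces are type variables: an existentially quantified
  constant inside the theorem could depend on them.\<close>

definition C_err :: real where "C_err = 1000"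

definition C_cost :: real where "C_cost = 32"

end

theory Submission
  imports Defs "HOL-Real_Asymp.Real_Asymp"
begin

text \<open>Let \<open>s\<close> denote the step from \<open>x k\<close> to \<open>x (k + 1)\<close> and \<open>e\<close> the error of \<open>G k\<close> as an estimate of the
gradient of the objective at \<open>x k\<close>. The error bound rests on the duality between \<open>infnorm\<close>, in which
the noise of an average of samples is only logarithmic in the dimension, and \<open>l1norm\<close>, in which the
distance term makes the objective decrease.

\<^bold>\<open>Descent.\<close> Smoothness and the variational inequality of the proximal step give a decrease of
\<open>32 * L * (l1norm s)\<^sup>2\<close>, up to the product of \<open>e\<close> and \<open>s\<close> and a multiple of the squared tolerance
(\<open>descent_lemma\<close>, \<open>inexact_prox_step_inner\<close>). The product is at most \<open>infnorm e * l1norm s\<close>, and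
Young's inequality pays for it with constants that do not see the dimension (\<open>one_step_descent\<close>).

\<^bold>\<open>Error.\<close> At the first iteration of a block the expected square of \<open>infnorm e\<close> is at most \<open>A / m1\<close>,
hence at most \<open>\<epsilon>\<^sup>2\<close> (\<open>block_start_err_bound\<close>). Within the block the new part of the error is an average
of \<open>m\<close> independent centred vectors whose Euclidean norm is at most \<open>2 * L\<close> times the distance from the
first iterate of the block, so its second moment is at most \<open>4 * L\<^sup>2 / m\<close> times the squared distance
(\<open>in_block_err_bound\<close>). That distance is a sum of at most \<open>q\<close> steps, and each step counts for fewer
than \<open>q\<close> later iterations; with \<open>m = q\<^sup>2\<close> the expected squared errors of the whole run sum to at most
\<open>2 * K * \<epsilon>\<^sup>2\<close> plus \<open>8 * L\<^sup>2\<close> times the sum of the expected squared steps (\<open>total_error\<close>).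

\<^bold>\<open>Conclusion.\<close> Telescoping the descent inequality bounds the squared steps by the errors
(\<open>total_steps\<close>), with a constant small enough to close the loop: the mean of the expected squared
steps is at most \<open>5 * (\<epsilon> / L)\<^sup>2\<close>. Since a negative multiple of the vector in the
variational inequality is normal to \<open>X\<close>, the distance to stationarity at \<open>x (k + 1)\<close> is bounded by \<open>infnorm e\<close>, the step and the tolerance
(\<open>dist_after_inexact_prox_step\<close>), and the uniform index \<open>Y\<close> turns means over the iterations into an
expectation (\<open>output_expectation\<close>).

Conditioning on the past appears as integration over a pair of outcomes, one for the past and one for
the fresh samples (\<open>indep_rv_integral_le\<close>). It needs joint measurability, which holds for the sampled
gradients by continuity in the point (\<open>borel_measurable_Caratheodory\<close>) and for the distance to
stationarity by lower semicontinuity (\<open>closed_sublevel_dist_constrained_subdiff\<close>).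

The number of samples is \<open>m\<close> per iteration plus \<open>m1\<close> per block, and \<open>m1 \<le> q ^ 3\<close> because \<open>q\<close> is a cube
root rounded up; so a block of \<open>q\<close> iterations costs at most \<open>2 * q ^ 3\<close> samples.\<close>

section \<open>Averaging over independent random variables\<close>

text \<open>The value types of \<open>U\<close> and \<open>V\<close> may differ, since a batch of samples is to be separated from the list
of past iterates.\<close>

lemma (in prob_space) indep_rv_distr_pair:
  assumes "indep_rv M S U T V"
  shows "distr M S U \<Otimes>\<^sub>M distr M T V = distr M (S \<Otimes>\<^sub>M T) (\<lambda>\<omega>. (U \<omega>, V \<omega>))"
proof -
  have U[measurable]: "U \<in> measurable M S" and V[measurable]: "V \<in> measurable M T"
    and ind: "indep_set {U -` B \<inter> space M |B. B \<in> sets S} {V -` B \<inter> space M |B. B \<in> sets T}"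
    using assms by (auto simp: indep_rv_def)
  interpret S: prob_space "distr M S U" by (rule prob_space_distr) simp
  interpret T: prob_space "distr M T V" by (rule prob_space_distr) simp
  show ?thesis
  proof (rule pair_measure_eqI)
    fix A B assume AB: "A \<in> sets (distr M S U)" "B \<in> sets (distr M T V)"
    then have [measurable]: "A \<in> sets S" "B \<in> sets T" by auto
    have "prob ((U -` A \<inter> space M) \<inter> (V -` B \<inter> space M))
        = prob (U -` A \<inter> space M) * prob (V -` B \<inter> space M)"
      using AB by (intro indep_setD[OF ind]) auto
    moreover have "(\<lambda>\<omega>. (U \<omega>, V \<omega>)) -` (A \<times> B) \<inter> space M
        = (U -` A \<inter> space M) \<inter> (V -` B \<inter> space M)" by auto
    ultimately show "emeasure (distr M S U) A * emeasure (distr M T V) B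
        = emeasure (distr M (S \<Otimes>\<^sub>M T) (\<lambda>\<omega>. (U \<omega>, V \<omega>))) (A \<times> B)"
      by (simp add: emeasure_distr emeasure_eq_measure ennreal_mult'')
  qed (auto intro: S.sigma_finite_measure_axioms T.sigma_finite_measure_axioms)
qed

lemma (in prob_space) indep_rv_nn_integral:
  assumes ind: "indep_rv M S U T V" and h[measurable]: "h \<in> borel_measurable (S \<Otimes>\<^sub>M T)"
  shows "(\<integral>\<^sup>+\<omega>. h (U \<omega>, V \<omega>) \<partial>M) = (\<integral>\<^sup>+\<omega>. (\<integral>\<^sup>+\<omega>'. h (U \<omega>', V \<omega>) \<partial>M) \<partial>M)"
proof -
  have U[measurable]: "U \<in> measurable M S" and V[measurable]: "V \<in> measurable M T"
    using ind by (auto simp: indep_rv_def)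
  interpret S: prob_space "distr M S U" by (rule prob_space_distr) simp
  interpret T: prob_space "distr M T V" by (rule prob_space_distr) simp
  interpret ST: pair_sigma_finite "distr M S U" "distr M T V" ..
  have "(\<integral>\<^sup>+\<omega>. h (U \<omega>, V \<omega>) \<partial>M) = (\<integral>\<^sup>+p. h p \<partial>(distr M S U \<Otimes>\<^sub>M distr M T V))"
    by (simp add: indep_rv_distr_pair[OF ind] nn_integral_distr)
  also have "\<dots> = (\<integral>\<^sup>+v. (\<integral>\<^sup>+u. h (u, v) \<partial>distr M S U) \<partial>distr M T V)"
    by (rule ST.nn_integral_snd[symmetric]) simp
  also have "\<dots> = (\<integral>\<^sup>+v. (\<integral>\<^sup>+\<omega>'. h (U \<omega>', v) \<partial>M) \<partial>distr M T V)"
    by (intro nn_integral_cong) (subst nn_integral_distr, auto)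
  also have "\<dots> = (\<integral>\<^sup>+\<omega>. (\<integral>\<^sup>+\<omega>'. h (U \<omega>', V \<omega>) \<partial>M) \<partial>M)"
    by (subst nn_integral_distr) auto
  finally show ?thesis .
qed

text \<open>This replaces conditioning on the past. The outcome \<open>\<omega>\<close> fixes the value of \<open>V\<close>, and the independent
variable \<open>U\<close> is averaged over a second outcome \<open>\<omega>'\<close> of the same space. A bound that holds for each
frozen value of \<open>V\<close> can then be averaged over \<open>V\<close>. The inner average lives on \<open>M\<close> itself rather
than on the law of \<open>U\<close>, so a moment bound for averages of independent vectors on \<open>M\<close> can be
used there as it stands.\<close>

lemma (in prob_space) indep_rv_integral_le:
  fixes h :: "'b \<times> 'c \<Rightarrow> real"
  assumes ind: "indep_rv M S U T V" and h[measurable]: "h \<in> borel_measurable (S \<Otimes>\<^sub>M T)"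
    and nonneg: "\<And>p. 0 \<le> h p"
    and inner: "\<And>\<omega>. \<omega> \<in> space M \<Longrightarrow> integrable M (\<lambda>\<omega>'. h (U \<omega>', V \<omega>))"
      "\<And>\<omega>. \<omega> \<in> space M \<Longrightarrow> (\<integral>\<omega>'. h (U \<omega>', V \<omega>) \<partial>M) \<le> b \<omega>"
    and b: "integrable M b"
  shows "integrable M (\<lambda>\<omega>. h (U \<omega>, V \<omega>))" "(\<integral>\<omega>. h (U \<omega>, V \<omega>) \<partial>M) \<le> (\<integral>\<omega>. b \<omega> \<partial>M)"
proof -
  have U[measurable]: "U \<in> measurable M S" and V[measurable]: "V \<in> measurable M T"
    using ind by (auto simp: indep_rv_def)
  have b0: "0 \<le> b \<omega>" if "\<omega> \<in> space M" for \<omega>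
    by (rule order_trans[OF Bochner_Integration.integral_nonneg[OF nonneg] inner(2)[OF that]])
  have "(\<integral>\<^sup>+\<omega>. h (U \<omega>, V \<omega>) \<partial>M) = (\<integral>\<^sup>+\<omega>. (\<integral>\<^sup>+\<omega>'. h (U \<omega>', V \<omega>) \<partial>M) \<partial>M)"
    by (rule indep_rv_nn_integral[OF ind, where h="\<lambda>p. ennreal (h p)"]) simp
  also have "\<dots> \<le> (\<integral>\<^sup>+\<omega>. b \<omega> \<partial>M)"
    using inner by (intro nn_integral_mono) (simp add: nn_integral_eq_integral nonneg ennreal_leI)
  also have "\<dots> = ennreal (\<integral>\<omega>. b \<omega> \<partial>M)"
    using b b0 by (intro nn_integral_eq_integral AE_I2) auto
  finally have le: "(\<integral>\<^sup>+\<omega>. h (U \<omega>, V \<omega>) \<partial>M) \<le> ennreal (\<integral>\<omega>. b \<omega> \<partial>M)" .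
  show int: "integrable M (\<lambda>\<omega>. h (U \<omega>, V \<omega>))"
    using le nonneg by (intro integrableI_nonneg) (auto simp: top.extremum_uniqueI order_le_less_trans)
  then have "ennreal (\<integral>\<omega>. h (U \<omega>, V \<omega>) \<partial>M) \<le> ennreal (\<integral>\<omega>. b \<omega> \<partial>M)"
    using le nonneg by (simp add: nn_integral_eq_integral)
  then show "(\<integral>\<omega>. h (U \<omega>, V \<omega>) \<partial>M) \<le> (\<integral>\<omega>. b \<omega> \<partial>M)"
    using b0 by (subst (asm) ennreal_le_iff) (auto intro!: Bochner_Integration.integral_nonneg_AE AE_I2)
qed

lemma (in prob_space) indep_vars_reindex:
  assumes inj: "inj_on f I" and ind: "indep_vars M' X (f ` I)"
  shows "indep_vars (\<lambda>i. M' (f i)) (\<lambda>i. X (f i)) I"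
  unfolding indep_vars_def2
proof (intro conjI ballI indep_setsI)
  fix i assume "i \<in> I"
  then show "random_variable (M' (f i)) (X (f i))" using ind by (auto simp: indep_vars_def)
next
  fix i assume "i \<in> I"
  then show "{X (f i) -` A \<inter> space M |A. A \<in> sets (M' (f i))} \<subseteq> events"
    using ind by (auto simp: indep_vars_def)
next
  fix A J assume J: "J \<noteq> {}" "J \<subseteq> I" "finite J"
    and A: "\<forall>j\<in>J. A j \<in> {X (f j) -` A \<inter> space M |A. A \<in> sets (M' (f j))}"
  have injJ: "inj_on f J" using inj J(2) by (rule inj_on_subset)
  \<comment> \<open>the events \<open>A j\<close>, indexed by the images \<open>f j\<close>\<close>
  define B where "B = A \<circ> the_inv_into J f"
  have B: "B (f j) = A j" if "j \<in> J" for j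
    using the_inv_into_f_f[OF injJ that] by (simp add: B_def)
  have "prob (\<Inter>l\<in>f ` J. B l) = (\<Prod>l\<in>f ` J. prob (B l))"
    by (rule indep_setsD[OF conjunct2[OF ind[unfolded indep_vars_def2]]]) (use J A B in auto)
  then show "prob (\<Inter>j\<in>J. A j) = (\<Prod>j\<in>J. prob (A j))"
    by (simp add: prod.reindex[OF injJ] B cong: prod.cong INF_cong)
qed

text \<open>A function that is continuous in one argument and measurable in the other is jointly measurable:
replace the continuous argument by a nearby point of a countable dense set, which gives a function
assembled from countably many measurable ones, and pass to the limit.\<close>

lemma borel_measurable_Caratheodory:
  fixes g :: "'a::{second_countable_topology, metric_space} \<Rightarrow> 'z \<Rightarrow> 'b::metric_space"
  assumes cont: "\<And>z. z \<in> space N \<Longrightarrow> continuous_on UNIV (\<lambda>x. g x z)"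
    and meas: "\<And>x. g x \<in> borel_measurable N"
  shows "(\<lambda>p. g (fst p) (snd p)) \<in> borel_measurable (borel \<Otimes>\<^sub>M N)"
proof -
  obtain C :: "'a set" where C: "countable C" "\<And>S. open S \<Longrightarrow> S \<noteq> {} \<Longrightarrow> \<exists>d\<in>C. d \<in> S"
    by (rule countable_dense_setE) blast
  have "C \<noteq> {}" using C(2)[of UNIV] by auto
  \<comment> \<open>the first point of the dense sequence at distance less than \<open>1 / Suc n\<close> from \<open>x\<close>\<close>
  define r where "r n x = from_nat_into C (LEAST i. dist (from_nat_into C i) x < 1 / Suc n)" for n :: nat and x
  have near: "dist (r n x) x < 1 / Suc n" for n x
  proof -
    obtain d where "d \<in> C" "d \<in> ball x (1 / Suc n)"
      using C(2)[of "ball x (1 / Suc n)"] by auto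
    then obtain i where "dist (from_nat_into C i) x < 1 / Suc n"
      by (metis C(1) dist_commute from_nat_into_surj mem_ball)
    then show ?thesis unfolding r_def by (rule LeastI)
  qed
  have lim: "(\<lambda>n. r n x) \<longlonglongrightarrow> x" for x
    unfolding lim_sequentially
  proof (intro allI impI)
    fix e :: real assume "e > 0"
    then obtain k where k: "1 / Suc k < e" using nat_approx_posE by blast
    have "dist (r n x) x < e" if "n \<ge> k" for n
    proof -
      have "1 / real (Suc n) \<le> 1 / real (Suc k)" using that by (simp add: frac_le)
      with near[of n x] k show ?thesis by linarith
    qed
    then show "\<exists>no. \<forall>n\<ge>no. dist (r n x) x < e" by auto
  qed
  show ?thesis
  proof (rule borel_measurable_LIMSEQ_metric)
    fix n
    have idx: "(\<lambda>p. LEAST i. dist (from_nat_into C i) (fst p) < 1 / Suc n)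
        \<in> measurable (borel \<Otimes>\<^sub>M N) (count_space UNIV)"
      by (intro measurable_Least) measurable
    show "(\<lambda>p. g (r n (fst p)) (snd p)) \<in> borel_measurable (borel \<Otimes>\<^sub>M N)"
      unfolding r_def
      by (rule measurable_compose_countable[OF _ idx]) (rule measurable_compose[OF measurable_snd meas])
  next
    fix p assume "p \<in> space (borel \<Otimes>\<^sub>M N :: ('a \<times> 'z) measure)"
    then have "snd p \<in> space N" by (auto simp: space_pair_measure)
    from cont[OF this] have "isCont (\<lambda>x. g x (snd p)) (fst p)"
      by (simp add: continuous_on_eq_continuous_at)
    then show "(\<lambda>n. g (r n (fst p)) (snd p)) \<longlonglongrightarrow> g (fst p) (snd p)"
      by (rule isCont_tendsto_compose) (rule lim)
  qed
qed

text \<open>Independent mean-zero vectors are orthogonal in \<open>L\<^sup>2\<close>, so only the diagonal terms of the expanded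
square survive. The bound is dimension-free, which is why it is stated for the Euclidean norm.\<close>

lemma (in prob_space) expectation_norm_sum_indep_le:
  fixes W :: "'i \<Rightarrow> 'a \<Rightarrow> 'b::euclidean_space" and R :: real
  assumes I: "finite I" and ind: "indep_vars (\<lambda>_. borel) W I"
    and mean: "\<And>i. i \<in> I \<Longrightarrow> has_bochner_integral M (W i) 0"
    and bound: "\<And>i \<omega>. i \<in> I \<Longrightarrow> \<omega> \<in> space M \<Longrightarrow> norm (W i \<omega>) \<le> R"
  shows "integrable M (\<lambda>\<omega>. (norm (\<Sum>i\<in>I. W i \<omega>))\<^sup>2)"
    "(\<integral>\<omega>. (norm (\<Sum>i\<in>I. W i \<omega>))\<^sup>2 \<partial>M) \<le> card I * R\<^sup>2"
proof -
  have W[measurable]: "i \<in> I \<Longrightarrow> W i \<in> borel_measurable M" for i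
    using ind by (auto simp: indep_vars_def)
  have prod_bound: "\<bar>W i \<omega> \<bullet> W j \<omega>\<bar> \<le> R\<^sup>2" if "i \<in> I" "j \<in> I" "\<omega> \<in> space M" for i j \<omega>
  proof -
    have "\<bar>W i \<omega> \<bullet> W j \<omega>\<bar> \<le> norm (W i \<omega>) * norm (W j \<omega>)" by (rule Cauchy_Schwarz_ineq2)
    also have "\<dots> \<le> R * R"
      using bound[OF that(1,3)] bound[OF that(2,3)] by (intro mult_mono) (auto intro: order_trans[OF norm_ge_zero])
    finally show ?thesis by (simp add: power2_eq_square)
  qed
  have int: "integrable M (\<lambda>\<omega>. W i \<omega> \<bullet> W j \<omega>)" if "i \<in> I" "j \<in> I" for i j
    using that prod_bound by (intro integrable_const_bound[where B="R\<^sup>2"] AE_I2) auto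
  have sq: "(norm (\<Sum>i\<in>I. W i \<omega>))\<^sup>2 = (\<Sum>i\<in>I. \<Sum>j\<in>I. W i \<omega> \<bullet> W j \<omega>)" for \<omega>
    by (simp add: power2_norm_eq_inner inner_sum_left inner_sum_right) (rule sum.swap)
  have orth: "(\<integral>\<omega>. W i \<omega> \<bullet> W j \<omega> \<partial>M) = 0" if ij: "i \<in> I" "j \<in> I" "i \<noteq> j" for i j
  proof -
    have comp: "(\<integral>\<omega>. (W i \<omega> \<bullet> b) * (W j \<omega> \<bullet> b) \<partial>M) = 0"
      "integrable M (\<lambda>\<omega>. (W i \<omega> \<bullet> b) * (W j \<omega> \<bullet> b))" for b
    proof -
      have wi: "has_bochner_integral M (\<lambda>\<omega>. W k \<omega> \<bullet> b) 0" if "k \<in> I" for k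
        using has_bochner_integral_inner_left[of b, OF mean[OF that]] by simp
      have "indep_var borel (W i) borel (W j)"
        using indep_var_compose[OF indep_var_restrict[OF ind, of "{i}" "{j}"],
            of "\<lambda>f. f i" borel "\<lambda>f. f j" borel] ij by (simp add: comp_def)
      from indep_var_compose[OF this, of "\<lambda>u. u \<bullet> b" borel "\<lambda>u. u \<bullet> b" borel]
      have iv: "indep_var borel (\<lambda>\<omega>. W i \<omega> \<bullet> b) borel (\<lambda>\<omega>. W j \<omega> \<bullet> b)"
        by (simp add: comp_def)
      show "(\<integral>\<omega>. (W i \<omega> \<bullet> b) * (W j \<omega> \<bullet> b) \<partial>M) = 0"
        using indep_var_lebesgue_integral[OF iv] wi[OF ij(1)] wi[OF ij(2)]
        by (simp add: has_bochner_integral_iff)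
      show "integrable M (\<lambda>\<omega>. (W i \<omega> \<bullet> b) * (W j \<omega> \<bullet> b))"
        using indep_var_integrable[OF iv] wi[OF ij(1)] wi[OF ij(2)]
        by (simp add: has_bochner_integral_iff)
    qed
    show ?thesis
      by (subst euclidean_inner) (simp add: comp Bochner_Integration.integral_sum)
  qed
  show "integrable M (\<lambda>\<omega>. (norm (\<Sum>i\<in>I. W i \<omega>))\<^sup>2)"
    unfolding sq using int by auto
  have "(\<integral>\<omega>. (norm (\<Sum>i\<in>I. W i \<omega>))\<^sup>2 \<partial>M) = (\<Sum>i\<in>I. \<Sum>j\<in>I. \<integral>\<omega>. W i \<omega> \<bullet> W j \<omega> \<partial>M)"
    unfolding sq using int
    by (simp add: Bochner_Integration.integral_sum Bochner_Integration.integrable_sum cong: sum.cong)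
  also have "\<dots> = (\<Sum>i\<in>I. \<Sum>j\<in>I. if j = i then (\<integral>\<omega>. W i \<omega> \<bullet> W i \<omega> \<partial>M) else 0)"
    by (intro sum.cong refl) (simp add: orth)
  also have "\<dots> = (\<Sum>i\<in>I. \<integral>\<omega>. W i \<omega> \<bullet> W i \<omega> \<partial>M)"
    using I by simp
  also have "\<dots> \<le> (\<Sum>i\<in>I. R\<^sup>2)"
  proof (rule sum_mono)
    fix i assume "i \<in> I"
    then have "(\<integral>\<omega>. W i \<omega> \<bullet> W i \<omega> \<partial>M) \<le> (\<integral>\<omega>. R\<^sup>2 \<partial>M)"
      using prod_bound[of i i] int by (intro integral_mono) (auto simp: abs_le_iff)
    then show "(\<integral>\<omega>. W i \<omega> \<bullet> W i \<omega> \<partial>M) \<le> R\<^sup>2" by (simp add: prob_space)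
  qed
  finally show "(\<integral>\<omega>. (norm (\<Sum>i\<in>I. W i \<omega>))\<^sup>2 \<partial>M) \<le> card I * R\<^sup>2" by simp
qed

section \<open>The $\ell_1$ norm and its square as distance term\<close>

lemma l1norm_nonneg: "0 \<le> l1norm z"
  unfolding l1norm_def by (intro sum_nonneg) simp

lemma l1norm_triangle: "l1norm (a + b) \<le> l1norm a + l1norm b"
  unfolding l1norm_def sum.distrib[symmetric] by (intro sum_mono) simp

lemma l1norm_scaleR: "l1norm (t *\<^sub>R z) = \<bar>t\<bar> * l1norm z"
  unfolding l1norm_def by (simp add: abs_mult sum_distrib_left)

lemma norm_le_l1norm: "norm z \<le> l1norm z"
  unfolding l1norm_def by (rule norm_le_l1_cart)

lemma infnorm_leI:
  fixes z :: "real ^ 'd"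
  assumes "\<And>i. \<bar>z $ i\<bar> \<le> B"
  shows "infnorm z \<le> B"
  unfolding infnorm_cart using assms by (intro cSup_least) auto

lemma inner_le_infnorm_l1norm:
  fixes a b :: "real ^ 'd"
  shows "\<bar>a \<bullet> b\<bar> \<le> infnorm a * l1norm b"
proof -
  have "\<bar>a \<bullet> b\<bar> \<le> (\<Sum>i\<in>UNIV. \<bar>a $ i * b $ i\<bar>)"
    unfolding inner_vec_def by (simp add: sum_abs)
  also have "\<dots> \<le> (\<Sum>i\<in>UNIV. infnorm a * \<bar>b $ i\<bar>)"
    by (intro sum_mono) (auto simp: abs_mult intro: mult_right_mono component_le_infnorm_cart)
  finally show ?thesis by (simp add: l1norm_def sum_distrib_left)
qed

lemma borel_measurable_l1norm [measurable]: "l1norm \<in> borel_measurable borel"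
  unfolding l1norm_def[abs_def] by measurable

lemma borel_measurable_infnorm [measurable]: "infnorm \<in> borel_measurable (borel :: (real ^ 'd) measure)"
  by (intro borel_measurable_continuous_onI continuous_intros)

text \<open>The dual norm of \<open>l1norm\<close> is \<open>infnorm\<close>, so a subgradient of \<open>\<rho>/2 * l1norm\<^sup>2\<close> at \<open>z\<close> has dual norm at
most \<open>\<rho> * l1norm z\<close>; since the function is homogeneous of degree two, Euler's relation bounds its
product with \<open>z\<close> from below by \<open>\<rho> * (l1norm z)\<^sup>2\<close>. Both come from the subgradient inequality along a
ray, as the step length tends to zero.\<close>

lemma dist_term_subgradient:
  fixes z \<xi> :: "real ^ 'd"
  assumes \<xi>: "\<xi> \<in> subdifferential (dist_term \<rho>) z" and \<rho>: "0 \<le> \<rho>"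
  shows dist_term_subgradient_infnorm: "infnorm \<xi> \<le> \<rho> * l1norm z"
    and dist_term_subgradient_inner: "\<rho> * (l1norm z)\<^sup>2 \<le> \<xi> \<bullet> z"
proof -
  have sub: "\<rho> / 2 * (l1norm u)\<^sup>2 \<ge> \<rho> / 2 * (l1norm z)\<^sup>2 + \<xi> \<bullet> (u - z)" for u
    using \<xi> by (simp add: subdifferential_def dist_term_def)
  show "infnorm \<xi> \<le> \<rho> * l1norm z"
  proof (rule infnorm_leI, rule field_le_epsilon)
    fix i :: 'd and e :: real assume e: "e > 0"
    \<comment> \<open>a step along a signed coordinate vector, short enough that \<open>\<rho> * t / 2 \<le> e\<close>\<close>
    define t where "t = 2 * e / (\<rho> + 1)"
    define v :: "real ^ 'd" where "v = axis i (sgn (\<xi> $ i))"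
    have t: "t > 0" using e \<rho> by (simp add: t_def)
    have v: "\<xi> \<bullet> v = \<bar>\<xi> $ i\<bar>" by (simp add: v_def inner_axis abs_sgn)
    have "l1norm v = (\<Sum>j\<in>UNIV. if j = i then \<bar>sgn (\<xi> $ i)\<bar> else 0)"
      unfolding l1norm_def v_def by (intro sum.cong) (auto simp: axis_def)
    then have "l1norm v \<le> 1" by (simp add: abs_sgn_eq)
    then have "l1norm (z + t *\<^sub>R v) \<le> l1norm z + t"
      using l1norm_triangle[of z "t *\<^sub>R v"] t by (simp add: l1norm_scaleR) (smt (verit) mult_left_le)
    then have "(l1norm (z + t *\<^sub>R v))\<^sup>2 \<le> (l1norm z + t)\<^sup>2"
      by (intro power_mono l1norm_nonneg)
    then have "\<rho> / 2 * (l1norm (z + t *\<^sub>R v))\<^sup>2 \<le> \<rho> / 2 * (l1norm z + t)\<^sup>2"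
      using \<rho> by (intro mult_left_mono) auto
    with sub[of "z + t *\<^sub>R v"] have "t * \<bar>\<xi> $ i\<bar> \<le> t * (\<rho> * l1norm z + \<rho> * t / 2)"
      by (simp add: v power2_eq_square algebra_simps)
    then have "\<bar>\<xi> $ i\<bar> \<le> \<rho> * l1norm z + \<rho> * t / 2" using t by simp
    also have "\<rho> * t / 2 \<le> e" using \<rho> e by (simp add: t_def field_simps)
    finally show "\<bar>\<xi> $ i\<bar> \<le> \<rho> * l1norm z + e" by simp
  qed
  show "\<rho> * (l1norm z)\<^sup>2 \<le> \<xi> \<bullet> z"
  proof (rule field_le_epsilon)
    fix e :: real assume e: "e > 0"
    define P where "P = \<rho> / 2 * (l1norm z)\<^sup>2"
    have P: "P \<ge> 0" using \<rho> by (simp add: P_def)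
    define t where "t = e / (P + 1)"
    have t: "t > 0" "t * P \<le> e" using e P by (simp_all add: t_def field_simps)
    \<comment> \<open>the subgradient inequality at the shrunken point \<open>(1 - t) *\<^sub>R z\<close>\<close>
    have "(1 - t)\<^sup>2 * P \<ge> P - t * (\<xi> \<bullet> z)"
    proof -
      have "(1 - t) *\<^sub>R z - z = - t *\<^sub>R z" by (simp add: algebra_simps)
      then show ?thesis
        using sub[of "(1 - t) *\<^sub>R z"]
        by (simp add: l1norm_scaleR P_def power_mult_distrib mult_ac)
    qed
    then have "t * (2 * P) \<le> t * (\<xi> \<bullet> z + t * P)"
      by (simp add: power2_eq_square algebra_simps)
    then have "2 * P \<le> \<xi> \<bullet> z + t * P" using t(1) by simp
    then show "\<rho> * (l1norm z)\<^sup>2 \<le> \<xi> \<bullet> z + e" using t(2) by (simp add: P_def)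
  qed
qed

section \<open>Gradients and the descent inequality\<close>

text \<open>The gradient is defined by a definite description; in finite dimension the derivative is
represented by exactly one vector, so the description is proper.\<close>

lemma gradient_GDERIV:
  fixes f :: "'a::euclidean_space \<Rightarrow> real"
  assumes "f differentiable (at x)"
  shows "GDERIV f x :> gradient f x"
  unfolding gradient_def
proof (rule theI')
  obtain f' where f': "(f has_derivative f') (at x)" using assms by (auto simp: differentiable_def)
  then interpret bounded_linear f' by (rule has_derivative_bounded_linear)
  have "f' h = h \<bullet> (\<Sum>b\<in>Basis. f' b *\<^sub>R b)" for h
  proof -
    have "f' h = f' (\<Sum>b\<in>Basis. (h \<bullet> b) *\<^sub>R b)" by (simp add: euclidean_representation)
    also have "\<dots> = h \<bullet> (\<Sum>b\<in>Basis. f' b *\<^sub>R b)"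
      by (simp add: sum scaleR inner_sum_right mult.commute)
    finally show ?thesis .
  qed
  then have ex: "GDERIV f x :> (\<Sum>b\<in>Basis. f' b *\<^sub>R b)"
    using f' unfolding gderiv_def by (metis (no_types, lifting) ext)
  show "\<exists>!g. GDERIV f x :> g"
  proof (rule ex1I, rule ex)
    fix g assume "GDERIV f x :> g"
    then have "(\<lambda>h. h \<bullet> g) = (\<lambda>h. h \<bullet> (\<Sum>b\<in>Basis. f' b *\<^sub>R b))"
      using ex unfolding gderiv_def by (rule has_derivative_unique)
    then show "g = (\<Sum>b\<in>Basis. f' b *\<^sub>R b)"
      by (metis (no_types) inner_commute vector_eq_rdot)
  qed
qed

text \<open>The function is differentiable everywhere, but its gradient is Lipschitz only on \<open>X\<close>. By convexity
the segment from \<open>x\<close> to \<open>y\<close> stays in \<open>X\<close>, and along it the difference of the two sides, as a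
function \<open>h\<close> of the parameter, has nonpositive derivative.\<close>

lemma descent_lemma:
  fixes f :: "'a::euclidean_space \<Rightarrow> real"
  assumes diff: "\<And>x. f differentiable (at x)" and X: "convex X" "x \<in> X" "y \<in> X"
    and Lip: "\<And>u v. u \<in> X \<Longrightarrow> v \<in> X \<Longrightarrow> norm (gradient f u - gradient f v) \<le> L * norm (u - v)"
  shows "f y \<le> f x + gradient f x \<bullet> (y - x) + L / 2 * (norm (y - x))\<^sup>2"
proof -
  define s where "s = y - x"
  define h where "h t = f (x + t *\<^sub>R s) - t * (gradient f x \<bullet> s) - L / 2 * t\<^sup>2 * (norm s)\<^sup>2" for t
  have der: "(h has_real_derivative
      (gradient f (x + t *\<^sub>R s) - gradient f x) \<bullet> s - L * t * (norm s)\<^sup>2) (at t)" for t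
  proof -
    have f': "(f has_derivative (\<lambda>h. h \<bullet> gradient f (x + t *\<^sub>R s))) (at (x + t *\<^sub>R s))"
      using gradient_GDERIV[OF diff] by (simp add: gderiv_def)
    have l: "((\<lambda>t. x + t *\<^sub>R s) has_derivative (\<lambda>h. h *\<^sub>R s)) (at t)"
      by (auto intro!: derivative_eq_intros)
    have "((\<lambda>t. f (x + t *\<^sub>R s)) has_derivative (\<lambda>h. (h *\<^sub>R s) \<bullet> gradient f (x + t *\<^sub>R s))) (at t)"
      using diff_chain_at[OF l f'] by (simp add: comp_def)
    then have "((\<lambda>t. f (x + t *\<^sub>R s)) has_real_derivative gradient f (x + t *\<^sub>R s) \<bullet> s) (at t)"
      by (simp add: has_field_derivative_def inner_commute mult_commute_abs)
    then show ?thesis unfolding h_def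
      by (auto intro!: derivative_eq_intros simp: inner_diff_left)
  qed
  have "h 1 \<le> h 0"
  proof (rule DERIV_nonpos_imp_nonincreasing[of 0 1])
    fix t :: real assume t: "0 \<le> t" "t \<le> 1"
    have "x + t *\<^sub>R s = (1 - t) *\<^sub>R x + t *\<^sub>R y" by (simp add: s_def algebra_simps)
    then have "x + t *\<^sub>R s \<in> X" using X t by (simp add: convexD)
    then have "norm (gradient f (x + t *\<^sub>R s) - gradient f x) \<le> L * (t * norm s)"
      using Lip[of "x + t *\<^sub>R s" x] X t by simp
    then have "(gradient f (x + t *\<^sub>R s) - gradient f x) \<bullet> s \<le> L * (t * norm s) * norm s"
      by (meson mult_right_mono norm_cauchy_schwarz norm_ge_zero order_trans)
    then show "\<exists>d. (h has_real_derivative d) (at t) \<and> d \<le> 0"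
      using der[of t] by (intro exI conjI) (auto simp: power2_eq_square algebra_simps)
  qed simp
  then show ?thesis by (simp add: h_def s_def)
qed

section \<open>One inexact proximal step\<close>

text \<open>The variational inequality of the step, tested at the old iterate \<open>x\<close>. The subgradient contributes
\<open>- \<rho> * (l1norm z)\<^sup>2\<close>, where \<open>z\<close> differs from the step \<open>x' - x\<close> by at most \<open>\<epsilon>h\<close> in the \<open>l1norm\<close>;
passing from \<open>z\<close> to the step costs a constant factor and a term of order \<open>\<epsilon>h\<^sup>2\<close>. The decrease in the
\<open>l1norm\<close> is what later absorbs gradient errors measured in \<open>infnorm\<close>.\<close>

lemma inexact_prox_step_inner:
  fixes x x' g :: "real ^ 'd"
  assumes st: "inexact_prox_step X (dist_term \<rho>) \<eta> \<epsilon>h x g x'"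
    and x: "x \<in> X" and \<rho>: "0 \<le> \<rho>" and \<epsilon>h: "0 \<le> \<epsilon>h"
  shows "\<eta> * (g \<bullet> (x' - x)) \<le> - (norm (x' - x))\<^sup>2 / 2 - \<rho> / 4 * (l1norm (x' - x))\<^sup>2 + (\<rho> + 1 / 2) * \<epsilon>h\<^sup>2"
proof -
  define s where "s = x' - x"
  obtain \<xi> \<Gamma> y where opt: "\<And>u. u \<in> X \<Longrightarrow> (x' - x + \<eta> *\<^sub>R g + \<xi> + \<Gamma>) \<bullet> (u - x') \<ge> 0"
    and \<xi>: "\<xi> \<in> subdifferential (dist_term \<rho>) (y - x)"
    and \<Gamma>: "norm \<Gamma> \<le> \<epsilon>h" and y: "l1norm (x' - y) \<le> \<epsilon>h"
    using st by (auto simp: inexact_prox_step_def)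
  define a where "a = l1norm (y - x)"
  have a0: "0 \<le> a" by (simp add: a_def l1norm_nonneg)
  have "x - x' = - s" by (simp add: s_def)
  with opt[OF x] have main: "\<eta> * (g \<bullet> s) \<le> - (norm s)\<^sup>2 - \<xi> \<bullet> s - \<Gamma> \<bullet> s"
    by (simp add: s_def[symmetric] inner_add_left power2_norm_eq_inner inner_add_right)
  have "\<bar>\<Gamma> \<bullet> s\<bar> \<le> \<epsilon>h * norm s"
    by (rule order_trans[OF Cauchy_Schwarz_ineq2]) (intro mult_right_mono \<Gamma> norm_ge_zero)
  also have "\<epsilon>h * norm s \<le> (norm s)\<^sup>2 / 2 + \<epsilon>h\<^sup>2 / 2"
    using sum_squares_bound[of \<epsilon>h "norm s"] by simp
  finally have \<Gamma>s: "- (\<Gamma> \<bullet> s) \<le> (norm s)\<^sup>2 / 2 + \<epsilon>h\<^sup>2 / 2" by simp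
  have "\<bar>\<xi> \<bullet> (x' - y)\<bar> \<le> infnorm \<xi> * l1norm (x' - y)" by (rule inner_le_infnorm_l1norm)
  also have "\<dots> \<le> (\<rho> * a) * \<epsilon>h"
    using dist_term_subgradient_infnorm[OF \<xi> \<rho>] y a0 \<rho>
    by (intro mult_mono) (auto simp: a_def[symmetric] l1norm_nonneg)
  finally have "\<xi> \<bullet> (x' - y) \<ge> - (\<rho> * a * \<epsilon>h)" by simp
  moreover have "\<xi> \<bullet> (y - x) \<ge> \<rho> * a\<^sup>2"
    using dist_term_subgradient_inner[OF \<xi> \<rho>] by (simp add: a_def)
  moreover have "s = (y - x) + (x' - y)" by (simp add: s_def)
  ultimately have "\<xi> \<bullet> s \<ge> \<rho> * (a\<^sup>2 - a * \<epsilon>h)"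
    by (simp only: inner_add_right) (simp add: algebra_simps)
  moreover have "a\<^sup>2 - a * \<epsilon>h \<ge> (l1norm s)\<^sup>2 / 4 - \<epsilon>h\<^sup>2"
  proof -
    have "l1norm s \<le> a + \<epsilon>h"
      using l1norm_triangle[of "y - x" "x' - y"] y by (simp add: a_def s_def)
    then have "(l1norm s)\<^sup>2 \<le> (a + \<epsilon>h)\<^sup>2" by (intro power_mono l1norm_nonneg)
    also have "\<dots> \<le> 2 * a\<^sup>2 + 2 * \<epsilon>h\<^sup>2"
      using sum_squares_bound[of a \<epsilon>h] by (simp add: power2_sum)
    finally show ?thesis using sum_squares_bound[of a \<epsilon>h] by simp
  qed
  then have "\<rho> * (a\<^sup>2 - a * \<epsilon>h) \<ge> \<rho> * ((l1norm s)\<^sup>2 / 4 - \<epsilon>h\<^sup>2)"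
    using \<rho> by (rule mult_left_mono)
  ultimately show ?thesis
    using main \<Gamma>s by (simp add: s_def[symmetric] algebra_simps)
qed

lemma dist_inf_zero_le: "v \<in> S \<Longrightarrow> dist_inf_zero S \<le> infnorm v"
  unfolding dist_inf_zero_def by (intro cINF_lower bdd_belowI2[where m=0]) (auto simp: infnorm_pos_le)

lemma zero_in_normal_cone: "x \<in> X \<Longrightarrow> 0 \<in> normal_cone X x"
  by (simp add: normal_cone_def)

lemma dist_inf_zero_nonneg: "x \<in> X \<Longrightarrow> 0 \<le> dist_inf_zero (constrained_subdiff f X x)"
  unfolding dist_inf_zero_def constrained_subdiff_def
  by (intro cINF_greatest) (auto simp: infnorm_pos_le dest: zero_in_normal_cone)

text \<open>Scaled by \<open>- L\<close>, the vector of the variational inequality lies in the normal cone at the new iterate.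
Added to the gradient there it cancels the estimate \<open>g\<close> up to the estimation error, and what remains
is controlled by the length of the step and by \<open>\<epsilon>h\<close>.\<close>

lemma dist_after_inexact_prox_step:
  fixes x x' g :: "real ^ 'd"
  assumes st: "inexact_prox_step X (dist_term \<rho>) (1 / L) \<epsilon>h x g x'"
    and x: "x \<in> X" and \<rho>: "0 \<le> \<rho>" and L: "0 < L"
    and Lip: "norm (gradient f x' - gradient f x) \<le> L * norm (x' - x)"
  shows "dist_inf_zero (constrained_subdiff f X x')
    \<le> infnorm (g - gradient f x) + (\<rho> + 2) * L * l1norm (x' - x) + (\<rho> + 1) * L * \<epsilon>h"
proof -
  define s where "s = x' - x"
  obtain \<xi> \<Gamma> y where x': "x' \<in> X" and opt: "\<And>u. u \<in> X \<Longrightarrow> (s + (1 / L) *\<^sub>R g + \<xi> + \<Gamma>) \<bullet> (u - x') \<ge> 0"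
    and \<xi>: "\<xi> \<in> subdifferential (dist_term \<rho>) (y - x)"
    and \<Gamma>: "norm \<Gamma> \<le> \<epsilon>h" and y: "l1norm (x' - y) \<le> \<epsilon>h"
    using st by (auto simp: inexact_prox_step_def s_def)
  define r where "r = s + \<xi> + \<Gamma>"
  define v where "v = - (g + L *\<^sub>R r)"
  have v_eq: "v = - (L *\<^sub>R (s + (1 / L) *\<^sub>R g + \<xi> + \<Gamma>))"
    using L by (simp add: v_def r_def algebra_simps)
  have "v \<in> normal_cone X x'"
    using opt x' L by (auto simp: normal_cone_def v_eq)
  then have "gradient f x' + v \<in> constrained_subdiff f X x'"
    by (simp add: constrained_subdiff_def)
  then have "dist_inf_zero (constrained_subdiff f X x') \<le> infnorm (gradient f x' + v)"
    by (rule dist_inf_zero_le)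
  also have "gradient f x' + v = (gradient f x' - gradient f x) + (- (g - gradient f x) + - (L *\<^sub>R r))"
    by (simp add: v_def)
  also have "infnorm \<dots> \<le> infnorm (gradient f x' - gradient f x) + (infnorm (g - gradient f x) + L * infnorm r)"
    using infnorm_triangle L
    by (smt (verit, best) infnorm_mul infnorm_neg)
  also have "infnorm (gradient f x' - gradient f x) \<le> L * l1norm s"
    using infnorm_le_norm Lip norm_le_l1norm[of s] L
    by (smt (verit, best) mult_left_mono s_def)
  also have "infnorm r \<le> l1norm s + \<rho> * (l1norm s + \<epsilon>h) + \<epsilon>h"
  proof -
    have "infnorm \<xi> \<le> \<rho> * l1norm (y - x)" by (rule dist_term_subgradient_infnorm[OF \<xi> \<rho>])
    also have "l1norm (y - x) \<le> l1norm s + \<epsilon>h"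
      using l1norm_triangle[of s "- 1 *\<^sub>R (x' - y)"] l1norm_scaleR[of "-1" "x' - y"] y
      by (simp add: s_def)
    finally have "infnorm \<xi> \<le> \<rho> * (l1norm s + \<epsilon>h)" using \<rho> by (simp add: mult_left_mono)
    moreover have "infnorm \<Gamma> \<le> \<epsilon>h" using infnorm_le_norm \<Gamma> by (rule order_trans)
    moreover have "infnorm s \<le> l1norm s" using infnorm_le_norm norm_le_l1norm by (rule order_trans)
    ultimately show ?thesis
      unfolding r_def using infnorm_triangle[of "s + \<xi>" \<Gamma>] infnorm_triangle[of s \<xi>] by linarith
  qed
  finally show ?thesis
    using L by (simp add: s_def[symmetric] algebra_simps)
qed

section \<open>Lower semicontinuity of the distance to stationarity\<close>

text \<open>The distance to stationarity need not be continuous in the point, but it is lower semicontinuous: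
near-minimal elements of the subdifferentials along a convergent sequence are bounded, and the
normal cone has a closed graph, so a cluster point is an element of the limiting subdifferential.
This is the source of its Borel measurability, hence of the meaning of its expectation.\<close>

lemma closed_sublevel_dist_constrained_subdiff:
  fixes X :: "(real ^ 'd) set"
  assumes X: "closed X" and cont: "continuous_on X (gradient f)"
  shows "closed {x \<in> X. dist_inf_zero (constrained_subdiff f X x) \<le> a}"
  unfolding closed_sequential_limits
proof (intro allI impI, elim conjE)
  fix u l assume u: "\<forall>n. u n \<in> {x \<in> X. dist_inf_zero (constrained_subdiff f X x) \<le> a}"
    and lim: "u \<longlonglongrightarrow> l"
  have uX: "u n \<in> X" for n using u by auto
  have lX: "l \<in> X" using closed_sequentially[OF X] uX lim by blast
  have "\<exists>w. w - gradient f (u n) \<in> normal_cone X (u n) \<and> infnorm w < a + 1 / Suc n" for n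
  proof -
    have "dist_inf_zero (constrained_subdiff f X (u n)) < a + 1 / Suc n"
      using u by (smt (verit) mem_Collect_eq of_nat_0_less_iff zero_less_Suc zero_less_divide_iff)
    then obtain w where "w \<in> constrained_subdiff f X (u n)" "infnorm w < a + 1 / Suc n"
      unfolding dist_inf_zero_def
      using zero_in_normal_cone[OF uX[of n]]
      by (subst (asm) cINF_less_iff)
        (auto simp: constrained_subdiff_def infnorm_pos_le intro!: bdd_belowI2[where m=0])
    then show ?thesis by (intro exI[of _ w]) (auto simp: constrained_subdiff_def)
  qed
  \<comment> \<open>near-minimal subgradients, written as \<open>w n = gradient f (u n) + v\<close> with \<open>v\<close> normal at \<open>u n\<close>\<close>
  then obtain w where wN: "\<And>n. w n - gradient f (u n) \<in> normal_cone X (u n)"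
    and wa: "\<And>n. infnorm (w n) < a + 1 / Suc n" by metis
  have "norm (w n) \<le> sqrt DIM(real ^ 'd) * (a + 1)" for n
  proof -
    have "infnorm (w n) \<le> a + 1" using wa[of n] by (smt (verit) divide_le_eq_1 of_nat_Suc of_nat_0_le_iff)
    then show ?thesis using norm_le_infnorm[of "w n"] by (smt (verit) mult_left_mono real_sqrt_ge_zero of_nat_0_le_iff)
  qed
  then have "\<forall>n. w n \<in> cball 0 (sqrt DIM(real ^ 'd) * (a + 1))" by simp
  with compact_cball obtain w' r where r: "strict_mono r" "(w \<circ> r) \<longlonglongrightarrow> w'"
    unfolding compact_def by metis
  have ur: "(\<lambda>n. u (r n)) \<longlonglongrightarrow> l" using LIMSEQ_subseq_LIMSEQ[OF lim r(1)] by (simp add: comp_def)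
  have wr: "(\<lambda>n. w (r n)) \<longlonglongrightarrow> w'" using r(2) by (simp add: comp_def)
  have gr: "(\<lambda>n. gradient f (u (r n))) \<longlonglongrightarrow> gradient f l"
    using cont lX ur uX by (auto simp: continuous_on_sequentially comp_def)
  have "w' - gradient f l \<in> normal_cone X l"
    unfolding normal_cone_def
  proof (intro CollectI conjI ballI lX)
    fix y assume y: "y \<in> X"
    have "(\<lambda>n. (w (r n) - gradient f (u (r n))) \<bullet> (y - u (r n))) \<longlonglongrightarrow> (w' - gradient f l) \<bullet> (y - l)"
      by (intro tendsto_intros wr gr ur)
    moreover have "(w (r n) - gradient f (u (r n))) \<bullet> (y - u (r n)) \<le> 0" for n
      using wN[of "r n"] y by (auto simp: normal_cone_def)
    ultimately show "(w' - gradient f l) \<bullet> (y - l) \<le> 0" by (intro LIMSEQ_le_const2) auto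
  qed
  then have "w' \<in> constrained_subdiff f X l"
    by (auto simp: constrained_subdiff_def intro!: image_eqI[of _ _ "w' - gradient f l"])
  then have "dist_inf_zero (constrained_subdiff f X l) \<le> infnorm w'" by (rule dist_inf_zero_le)
  also have "infnorm w' \<le> a"
  proof (rule LIMSEQ_le)
    show "(\<lambda>n. infnorm (w (r n))) \<longlonglongrightarrow> infnorm w'" by (intro tendsto_intros wr)
    have "(\<lambda>n. a + 1 / Suc n) \<longlonglongrightarrow> a + 0"
      by (intro tendsto_intros LIMSEQ_Suc[OF lim_1_over_n])
    from LIMSEQ_subseq_LIMSEQ[OF this r(1)]
    show "(\<lambda>n. a + 1 / Suc (r n)) \<longlonglongrightarrow> a" by (simp add: comp_def)
    show "\<exists>N. \<forall>n\<ge>N. infnorm (w (r n)) \<le> a + 1 / Suc (r n)" using wa less_imp_le by blast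
  qed
  finally show "l \<in> {x \<in> X. dist_inf_zero (constrained_subdiff f X x) \<le> a}" using lX by simp
qed

lemma borel_measurable_dist_constrained_subdiff:
  fixes X :: "(real ^ 'd) set"
  assumes X: "convex X" "closed X" "X \<noteq> {}" and cont: "continuous_on X (gradient f)"
  shows "(\<lambda>x. dist_inf_zero (constrained_subdiff f X (closest_point X x))) \<in> borel_measurable borel"
proof (subst borel_measurable_iff_le, intro allI)
  fix a
  let ?C = "{x \<in> X. dist_inf_zero (constrained_subdiff f X x) \<le> a}"
  have "closed (closest_point X -` ?C)"
    using continuous_on_closest_point[OF X] closed_sublevel_dist_constrained_subdiff[OF X(2) cont]
    by (rule closed_vimage[rotated])
  moreover have "{x \<in> space borel. dist_inf_zero (constrained_subdiff f X (closest_point X x)) \<le> a}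
      = closest_point X -` ?C"
    using closest_point_in_set[OF X(2,3)] by auto
  ultimately show "{x \<in> space borel. dist_inf_zero (constrained_subdiff f X (closest_point X x)) \<le> a} \<in> sets borel"
    by simp
qed

section \<open>Noise of the sampled gradients\<close>

context stochastic_problem
begin

abbreviation f :: "real ^ 'd \<Rightarrow> real" where "f \<equiv> objective D F"

definition noise :: "real ^ 'd \<Rightarrow> 'z \<Rightarrow> real ^ 'd" where
  "noise u z = grad_sample F u z - gradient f u"

lemma noise_integral: "u \<in> X \<Longrightarrow> has_bochner_integral D (noise u) 0"
  using noise_mean_zero by (simp add: noise_def[abs_def])

lemma noise_measurable: "u \<in> X \<Longrightarrow> noise u \<in> borel_measurable D"
  using noise_integral by (blast intro: has_bochner_integral_iff[THEN iffD1, THEN conjunct1] borel_measurable_integrable)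

text \<open>Because the noise has mean zero, the gradient of the objective is the mean of the sampled gradients
and inherits their Lipschitz constant.\<close>

lemma gradient_Lipschitz:
  assumes "u \<in> X" "v \<in> X"
  shows "norm (gradient f u - gradient f v) \<le> L * norm (u - v)"
proof -
  let ?g = "\<lambda>z. grad_sample F u z - grad_sample F v z"
  have "has_bochner_integral D (\<lambda>z. gradient f u - gradient f v) (gradient f u - gradient f v)"
    by (simp add: has_bochner_integral_iff D.prob_space)
  from has_bochner_integral_add[OF has_bochner_integral_diff[OF noise_integral[OF assms(1)]
      noise_integral[OF assms(2)]] this]
  have g: "has_bochner_integral D ?g (gradient f u - gradient f v)"
    by (simp add: noise_def)
  then have "norm (gradient f u - gradient f v) \<le> (\<integral>z. norm (?g z) \<partial>D)"
    using integral_norm_bound[of D ?g] by (simp add: has_bochner_integral_iff)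
  also have "\<dots> \<le> (\<integral>z. L * norm (u - v) \<partial>D)"
    using g by (intro integral_mono) (auto simp: has_bochner_integral_iff intro: grad_Lipschitz assms)
  finally show ?thesis by (simp add: D.prob_space)
qed

lemma gradient_continuous: "continuous_on X (gradient f)"
proof (rule continuous_onI)
  fix u and e :: real assume u: "u \<in> X" "e > 0"
  have "dist (gradient f v) (gradient f u) \<le> e" if "v \<in> X" "dist v u < e / L" for v
    using gradient_Lipschitz[OF that(1) u(1)] that(2) L_pos
    by (simp add: dist_norm pos_less_divide_eq mult.commute)
  then show "\<exists>d>0. \<forall>v\<in>X. dist v u < d \<longrightarrow> dist (gradient f v) (gradient f u) \<le> e"
    using u L_pos by (intro exI[of _ "e / L"]) auto
qed

lemma noise_diff_bound:
  assumes "u \<in> X" "v \<in> X" "z \<in> space D"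
  shows "norm (noise u z - noise v z) \<le> 2 * L * norm (u - v)"
  using norm_triangle_ineq4[of "grad_sample F u z - grad_sample F v z" "gradient f u - gradient f v"]
    gradient_Lipschitz[OF assms(1,2)] grad_Lipschitz[OF assms]
  by (simp add: noise_def algebra_simps)

text \<open>Lipschitz continuity and measurability of the sampled gradients are known on \<open>X\<close> only. Composition
with the projection onto \<open>X\<close> gives functions on the whole space that agree with the original ones at
the iterates, so that joint measurability can be asked of them.\<close>

abbreviation proj :: "real ^ 'd \<Rightarrow> real ^ 'd" where "proj \<equiv> closest_point X"

lemma proj_in: "proj u \<in> X"
  using X_closed X_nonempty by (rule closest_point_in_set)

lemma proj_continuous: "continuous_on UNIV proj"
  using X_convex X_closed X_nonempty by (rule continuous_on_closest_point)

lemma noise_proj_measurable [measurable]: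
  "(\<lambda>p. noise (proj (fst p)) (snd p)) \<in> borel_measurable (borel \<Otimes>\<^sub>M D)"
proof (rule borel_measurable_Caratheodory)
  fix z assume z: "z \<in> space D"
  have "continuous_on X (\<lambda>u. noise u z)"
  proof (rule continuous_onI)
    fix u and e :: real assume u: "u \<in> X" "e > 0"
    have "dist (noise v z) (noise u z) \<le> e" if "v \<in> X" "dist v u < e / (2 * L)" for v
      using noise_diff_bound[OF that(1) u(1) z] that(2) L_pos
      by (simp add: dist_norm pos_less_divide_eq mult_ac)
    then show "\<exists>d>0. \<forall>v\<in>X. dist v u < d \<longrightarrow> dist (noise v z) (noise u z) \<le> e"
      using u L_pos by (intro exI[of _ "e / (2 * L)"]) auto
  qed
  then show "continuous_on UNIV (\<lambda>u. noise (proj u) z)"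
    by (rule continuous_on_compose2[OF _ proj_continuous]) (auto intro: proj_in)
qed (intro noise_measurable proj_in)

lemma noise_proj_measurable_compose:
  assumes "g \<in> borel_measurable N" "h \<in> measurable N D"
  shows "(\<lambda>y. noise (proj (g y)) (h y)) \<in> borel_measurable N"
  using measurable_compose[OF measurable_Pair[OF assms] noise_proj_measurable] by simp

lemma objective_measurable [measurable]: "f \<in> borel_measurable borel"
proof (rule borel_measurable_continuous_onI)
  show "continuous_on UNIV f"
    using f_differentiable differentiable_imp_continuous_within
    by (auto simp: continuous_on_eq_continuous_at)
qed

end

section \<open>Error of the variance-reduced gradient estimate\<close>

context disfom_vr_run
begin

definition err :: "nat \<Rightarrow> 'w \<Rightarrow> real ^ 'd" where
  "err k \<omega> = G k \<omega> - gradient f (x k \<omega>)"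

lemma x_in_X:
  assumes "k \<in> {1..K + 1}" "\<omega> \<in> space M"
  shows "x k \<omega> \<in> X"
proof (cases "k = 1")
  case False
  then have "k - 1 \<in> {1..K}" "k - 1 + 1 = k" using assms(1) by auto
  then show ?thesis using step[of "k - 1" \<omega>] assms(2) by (simp add: inexact_prox_step_def)
qed (use x1_in_X assms in simp)

lemma proj_x: "k \<in> {1..K + 1} \<Longrightarrow> \<omega> \<in> space M \<Longrightarrow> proj (x k \<omega>) = x k \<omega>"
  by (intro closest_point_self x_in_X)

lemma block_start_props:
  assumes "k \<ge> 1"
  shows "1 \<le> block_start q k" "block_start q k \<le> k" "k < block_start q k + q"
    "block_start q (block_start q k) = block_start q k"
proof -
  have "(k - 1) div q * q \<le> k - 1" "k - 1 < (k - 1) div q * q + q"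
    using params_pos(2) dividend_less_div_times[of q "k - 1"] by (simp_all add: div_times_less_eq_dividend)
  then show "1 \<le> block_start q k" "block_start q k \<le> k" "k < block_start q k + q"
    unfolding block_start_def using assms by linarith+
  show "block_start q (block_start q k) = block_start q k"
    using params_pos(2) by (simp add: block_start_def)
qed

lemma sample_measurable:
  assumes "k \<in> {1..K}" "i \<in> {1..batch_size q m m1 k}"
  shows "\<zeta> k i \<in> measurable M D"
proof -
  have "(k, i) \<in> sample_index K q m m1" using assms by (simp add: sample_index_def)
  then show ?thesis using samples_indep by (auto simp: P.indep_vars_def)
qed

lemma sample_distr:
  assumes "k \<in> {1..K}" "i \<in> {1..batch_size q m m1 k}"
  shows "distr M D (\<zeta> k i) = D"
  using assms by (intro samples_distr) (simp add: sample_index_def)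

lemma batch_indep:
  assumes "k \<in> {1..K}"
  shows "P.indep_vars (\<lambda>_. D) (\<zeta> k) {1..batch_size q m m1 k}"
proof -
  let ?I = "{1..batch_size q m m1 k}"
  have "Pair k ` ?I \<subseteq> sample_index K q m m1" using assms by (auto simp: sample_index_def)
  from P.indep_vars_reindex[OF _ P.indep_vars_subset[OF samples_indep this]]
  show ?thesis by (simp add: inj_on_def)
qed

lemma sample_integral:
  fixes h :: "'z \<Rightarrow> 'b::{banach, second_countable_topology}"
  assumes "k \<in> {1..K}" "i \<in> {1..batch_size q m m1 k}" and h: "has_bochner_integral D h a"
  shows "has_bochner_integral M (\<lambda>\<omega>. h (\<zeta> k i \<omega>)) a"
proof -
  have [measurable]: "h \<in> borel_measurable D" using h by (auto simp: has_bochner_integral_iff)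
  note [measurable] = sample_measurable[OF assms(1,2)]
  have "has_bochner_integral (distr M D (\<zeta> k i)) h a"
    using h by (simp add: sample_distr[OF assms(1,2)])
  then show ?thesis
    using integrable_distr_eq[OF sample_measurable[OF assms(1,2)], of h]
      integral_distr[OF sample_measurable[OF assms(1,2)], of h]
    by (simp add: has_bochner_integral_iff)
qed

lemma noise_batch_measurable:
  assumes k: "k \<in> {1..K}" and j: "j \<in> {1..K + 1}" and i: "i \<in> {1..batch_size q m m1 k}"
  shows "(\<lambda>\<omega>. noise (x j \<omega>) (\<zeta> k i \<omega>)) \<in> borel_measurable M"
proof -
  have "(\<lambda>\<omega>. noise (proj (x j \<omega>)) (\<zeta> k i \<omega>)) \<in> borel_measurable M"
    by (intro noise_proj_measurable_compose x_measurable sample_measurable assms)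
  then show ?thesis
    using proj_x[OF j] by (simp cong: measurable_cong)
qed

lemma err_block_start:
  assumes k: "k \<in> {1..K}" "k = block_start q k" and \<omega>: "\<omega> \<in> space M"
  shows "err k \<omega> = (1 / real m1) *\<^sub>R (\<Sum>i=1..m1. noise (x k \<omega>) (\<zeta> k i \<omega>))"
proof -
  have "real m1 \<noteq> 0" using params_pos(4) by simp
  then show ?thesis
    using G_block_start[OF k(1) \<omega> k(2)]
    by (simp add: err_def noise_def sum_subtractf scaleR_diff_right sum_constant_scaleR
        del: sum_constant)
qed

lemma err_in_block:
  assumes k: "k \<in> {1..K}" "k \<noteq> block_start q k" and \<omega>: "\<omega> \<in> space M"
  shows "err k \<omega> = (1 / real m) *\<^sub>R (\<Sum>i=1..m. noise (x k \<omega>) (\<zeta> k i \<omega>) - noise (x (block_start q k) \<omega>) (\<zeta> k i \<omega>))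
    + err (block_start q k) \<omega>"
proof -
  have "real m \<noteq> 0" using params_pos(3) by simp
  then show ?thesis
    using G_in_block[OF k(1) \<omega> k(2)]
    by (simp add: err_def noise_def sum_subtractf scaleR_diff_right sum_constant_scaleR
        del: sum_constant)
qed

lemma err_measurable:
  assumes k: "k \<in> {1..K}"
  shows "err k \<in> borel_measurable M"
proof -
  have start: "err k \<in> borel_measurable M" if k: "k \<in> {1..K}" "k = block_start q k" for k
  proof -
    have "(\<lambda>\<omega>. (1 / real m1) *\<^sub>R (\<Sum>i=1..m1. noise (x k \<omega>) (\<zeta> k i \<omega>))) \<in> borel_measurable M"
      using k by (intro borel_measurable_scaleR borel_measurable_const borel_measurable_sum
          noise_batch_measurable) (auto simp: batch_size_def)
    then show ?thesis using err_block_start[OF k] by (simp cong: measurable_cong)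
  qed
  show ?thesis
  proof (cases "k = block_start q k")
    case False
    let ?n = "block_start q k"
    have n: "?n \<in> {1..K}" "?n = block_start q ?n" using block_start_props[of k] k by auto
    have "(\<lambda>\<omega>. (1 / real m) *\<^sub>R (\<Sum>i=1..m. noise (x k \<omega>) (\<zeta> k i \<omega>) - noise (x ?n \<omega>) (\<zeta> k i \<omega>))
        + err ?n \<omega>) \<in> borel_measurable M"
      using k n False by (intro borel_measurable_add start borel_measurable_scaleR borel_measurable_const
          borel_measurable_sum borel_measurable_diff noise_batch_measurable) (auto simp: batch_size_def)
    then show ?thesis using err_in_block[OF k False] by (simp cong: measurable_cong)
  qed (use start k in blast)
qed

text \<open>With the iterate frozen at a point of \<open>X\<close>, the error is an average of \<open>m1\<close> independent centred
subgaussian vectors on the probability space \<open>M\<close> itself, to which the averaging constant applies.\<close>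

lemma block_start_err_bound:
  assumes c: "averaging_constant TYPE('w) TYPE('d) c"
    and k: "k \<in> {1..K}" "k = block_start q k"
  shows "integrable M (\<lambda>\<omega>. (infnorm (err k \<omega>))\<^sup>2)"
    "(\<integral>\<omega>. (infnorm (err k \<omega>))\<^sup>2 \<partial>M) \<le> c * ln (real CARD('d)) * \<sigma>\<^sup>2 / real m1"
proof -
  have b: "batch_size q m m1 k = m1" using k by (simp add: batch_size_def)
  let ?B = "c * ln (real CARD('d)) * \<sigma>\<^sup>2 / real m1"
  let ?h = "\<lambda>p. (infnorm ((1 / real m1) *\<^sub>R (\<Sum>i=1..m1. noise (proj (snd p k)) (fst p i))))\<^sup>2"
  let ?U = "\<lambda>\<omega>. \<lambda>i\<in>{1..m1}. \<zeta> k i \<omega>" and ?V = "\<lambda>\<omega>. \<lambda>j\<in>{1..k}. x j \<omega>"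
  have ind: "indep_rv M (\<Pi>\<^sub>M i\<in>{1..m1}. D) ?U (\<Pi>\<^sub>M j\<in>{1..k}. borel) ?V"
    using samples_indep_past[OF k(1)] by (simp add: b)
  have h: "?h \<in> borel_measurable ((\<Pi>\<^sub>M i\<in>{1..m1}. D) \<Otimes>\<^sub>M (\<Pi>\<^sub>M j\<in>{1..k}. borel))"
  proof -
    have "(\<lambda>p. noise (proj (snd p k)) (fst p i))
        \<in> borel_measurable ((\<Pi>\<^sub>M i\<in>{1..m1}. D) \<Otimes>\<^sub>M (\<Pi>\<^sub>M j\<in>{1..k}. borel))" if "i \<in> {1..m1}" for i
      using that k(1) by (intro noise_proj_measurable_compose measurable_compose[OF measurable_snd]
          measurable_compose[OF measurable_fst] measurable_component_singleton) auto
    then show ?thesis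
      by (intro borel_measurable_power measurable_compose[OF _ borel_measurable_infnorm]
          borel_measurable_scaleR borel_measurable_const borel_measurable_sum) auto
  qed
  have avg: "integrable M (\<lambda>\<omega>'. (infnorm ((1 / real m1) *\<^sub>R (\<Sum>i=1..m1. noise u (\<zeta> k i \<omega>'))))\<^sup>2) \<and>
      (\<integral>\<omega>'. (infnorm ((1 / real m1) *\<^sub>R (\<Sum>i=1..m1. noise u (\<zeta> k i \<omega>'))))\<^sup>2 \<partial>M) \<le> ?B" if u: "u \<in> X" for u
  proof -
    note [measurable] = noise_measurable[OF u] sample_measurable[OF k(1), unfolded b]
    have distr_noise: "distr M borel (\<lambda>\<omega>. noise u (\<zeta> k i \<omega>)) = distr D borel (noise u)" if "i \<in> {1..m1}" for i
      using that by (subst (2) sample_distr[OF k(1), unfolded b, OF that, symmetric], subst distr_distr)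
        (auto simp: comp_def)
    have "P.indep_vars (\<lambda>_. borel) (\<lambda>i \<omega>. noise u (\<zeta> k i \<omega>)) {1..m1}"
      using P.indep_vars_compose2[OF batch_indep[OF k(1), unfolded b], of "\<lambda>_. noise u" "\<lambda>_. borel"] noise_measurable[OF u] by simp
    moreover have "has_bochner_integral M (\<lambda>\<omega>. noise u (\<zeta> k i \<omega>)) 0" if "i \<in> {1..m1}" for i
      using sample_integral[OF k(1) _ noise_integral[OF u]] that b by simp
    moreover have "subgaussian_components M (\<lambda>\<omega>. noise u (\<zeta> k i \<omega>)) \<sigma>" if i: "i \<in> {1..m1}" for i
      unfolding subgaussian_components_def
    proof (intro allI)
      fix t j
      let ?e = "\<lambda>z. exp (t * noise u z $ j)"
      have e: "integrable D ?e" "(\<integral>z. ?e z \<partial>D) \<le> exp (\<sigma>\<^sup>2 * t\<^sup>2 / 2)"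
        using noise_subgaussian[OF u] by (auto simp: subgaussian_components_def noise_def)
      have "has_bochner_integral M (\<lambda>\<omega>. ?e (\<zeta> k i \<omega>)) (\<integral>z. ?e z \<partial>D)"
        using sample_integral[OF k(1) _ has_bochner_integral_integrable[OF e(1)]] i b by simp
      with e(2) show "integrable M (\<lambda>\<omega>. exp (t * noise u (\<zeta> k i \<omega>) $ j)) \<and>
          (\<integral>\<omega>. exp (t * noise u (\<zeta> k i \<omega>) $ j) \<partial>M) \<le> exp (\<sigma>\<^sup>2 * t\<^sup>2 / 2)"
        by (simp add: has_bochner_integral_iff)
    qed
    ultimately show ?thesis
      using c[unfolded averaging_constant_def, rule_format, of M m1 \<sigma> "\<lambda>i \<omega>. noise u (\<zeta> k i \<omega>)"]
        distr_noise params_pos(4) \<sigma>_pos P.prob_space_axioms by auto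
  qed
  have hV: "?h (?U \<omega>', ?V \<omega>) = (infnorm ((1 / real m1) *\<^sub>R (\<Sum>i=1..m1. noise (x k \<omega>) (\<zeta> k i \<omega>'))))\<^sup>2"
    if "\<omega> \<in> space M" for \<omega> \<omega>'
    using that k(1) proj_x[of k \<omega>] by (simp cong: sum.cong_simp)
  note bnd = P.indep_rv_integral_le[OF ind h, of "\<lambda>_. ?B"]
  have inner: "integrable M (\<lambda>\<omega>'. ?h (?U \<omega>', ?V \<omega>))" "(\<integral>\<omega>'. ?h (?U \<omega>', ?V \<omega>) \<partial>M) \<le> ?B" if "\<omega> \<in> space M" for \<omega>
    using avg[OF x_in_X[of k \<omega>]] that k(1) by (simp_all only: hV[OF that]) auto
  have eq: "?h (?U \<omega>, ?V \<omega>) = (infnorm (err k \<omega>))\<^sup>2" if "\<omega> \<in> space M" for \<omega>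
    by (simp only: hV[OF that] err_block_start[OF k that])
  have hb: "integrable M (\<lambda>\<omega>. ?h (?U \<omega>, ?V \<omega>))" "(\<integral>\<omega>. ?h (?U \<omega>, ?V \<omega>) \<partial>M) \<le> (\<integral>\<omega>. ?B \<partial>M)"
    using inner by (intro bnd; simp)+
  show "integrable M (\<lambda>\<omega>. (infnorm (err k \<omega>))\<^sup>2)"
    by (rule iffD1[OF Bochner_Integration.integrable_cong[OF refl eq] hb(1)])
  have "(\<integral>\<omega>. ?h (?U \<omega>, ?V \<omega>) \<partial>M) = (\<integral>\<omega>. (infnorm (err k \<omega>))\<^sup>2 \<partial>M)"
    by (rule Bochner_Integration.integral_cong[OF refl eq])
  with hb(2) show "(\<integral>\<omega>. (infnorm (err k \<omega>))\<^sup>2 \<partial>M) \<le> ?B"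
    by (simp add: P.prob_space del: restrict_apply)
qed

text \<open>Inside a block the estimate adds to the error at the block start an average of \<open>m\<close> differences of
noise at two iterates. Each difference is at most \<open>2 * L\<close> times the Euclidean distance of the
iterates, and orthogonality gains the factor \<open>1 / m\<close>. Estimating this term in the Euclidean norm,
which dominates \<open>infnorm\<close>, keeps it free of a factor \<open>ln CARD('d)\<close> that the batch size \<open>m\<close> is not
meant to compensate.\<close>

lemma in_block_err_bound:
  assumes k: "k \<in> {1..K}" "k \<noteq> block_start q k"
    and n: "n = block_start q k"
    and int: "integrable M (\<lambda>\<omega>. (infnorm (err n \<omega>))\<^sup>2)" "integrable M (\<lambda>\<omega>. (norm (x k \<omega> - x n \<omega>))\<^sup>2)"
  shows "integrable M (\<lambda>\<omega>. (infnorm (err k \<omega>))\<^sup>2)"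
    "(\<integral>\<omega>. (infnorm (err k \<omega>))\<^sup>2 \<partial>M) \<le> 2 * (\<integral>\<omega>. (infnorm (err n \<omega>))\<^sup>2 \<partial>M)
      + 8 * L\<^sup>2 / real m * (\<integral>\<omega>. (norm (x k \<omega> - x n \<omega>))\<^sup>2 \<partial>M)"
proof -
  have b: "batch_size q m m1 k = m" using k by (simp add: batch_size_def)
  have n1: "n \<in> {1..k}" using block_start_props[of k] k(1) n by auto
  let ?D = "\<lambda>u v \<omega>. (1 / real m) *\<^sub>R (\<Sum>i=1..m. noise u (\<zeta> k i \<omega>) - noise v (\<zeta> k i \<omega>))"
  let ?b = "\<lambda>\<omega>. 4 * L\<^sup>2 / real m * (norm (x k \<omega> - x n \<omega>))\<^sup>2"
  let ?h = "\<lambda>p. (norm ((1 / real m) *\<^sub>R (\<Sum>i=1..m. noise (proj (snd p k)) (fst p i) - noise (proj (snd p n)) (fst p i))))\<^sup>2"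
  let ?U = "\<lambda>\<omega>. \<lambda>i\<in>{1..m}. \<zeta> k i \<omega>" and ?V = "\<lambda>\<omega>. \<lambda>j\<in>{1..k}. x j \<omega>"
  have ind: "indep_rv M (\<Pi>\<^sub>M i\<in>{1..m}. D) ?U (\<Pi>\<^sub>M j\<in>{1..k}. borel) ?V"
    using samples_indep_past[OF k(1)] by (simp add: b)
  have h: "?h \<in> borel_measurable ((\<Pi>\<^sub>M i\<in>{1..m}. D) \<Otimes>\<^sub>M (\<Pi>\<^sub>M j\<in>{1..k}. borel))"
  proof -
    have "(\<lambda>p. noise (proj (snd p j)) (fst p i))
        \<in> borel_measurable ((\<Pi>\<^sub>M i\<in>{1..m}. D) \<Otimes>\<^sub>M (\<Pi>\<^sub>M j\<in>{1..k}. borel))" if "i \<in> {1..m}" "j \<in> {1..k}" for i j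
      using that by (intro noise_proj_measurable_compose measurable_compose[OF measurable_snd]
          measurable_compose[OF measurable_fst] measurable_component_singleton) auto
    then show ?thesis using n1 k(1)
      by (intro borel_measurable_power borel_measurable_norm
          borel_measurable_scaleR borel_measurable_const borel_measurable_sum borel_measurable_diff) auto
  qed
  have avg: "integrable M (\<lambda>\<omega>. (norm (?D u v \<omega>))\<^sup>2) \<and>
      (\<integral>\<omega>. (norm (?D u v \<omega>))\<^sup>2 \<partial>M) \<le> 4 * L\<^sup>2 / real m * (norm (u - v))\<^sup>2" if uv: "u \<in> X" "v \<in> X" for u v
  proof -
    let ?W = "\<lambda>i \<omega>. noise u (\<zeta> k i \<omega>) - noise v (\<zeta> k i \<omega>)"
    have Wm: "(\<lambda>z. noise u z - noise v z) \<in> borel_measurable D"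
      using noise_measurable uv by simp
    have W: "has_bochner_integral D (\<lambda>z. noise u z - noise v z) 0"
      using has_bochner_integral_diff[OF noise_integral[OF uv(1)] noise_integral[OF uv(2)]] by simp
    have 1: "P.indep_vars (\<lambda>_. borel) ?W {1..m}"
      using P.indep_vars_compose2[OF batch_indep[OF k(1), unfolded b], of "\<lambda>_ z. noise u z - noise v z" "\<lambda>_. borel"] Wm by simp
    have 2: "has_bochner_integral M (?W i) 0" if "i \<in> {1..m}" for i
      using sample_integral[OF k(1) _ W] that b by simp
    have 3: "norm (?W i \<omega>) \<le> 2 * L * norm (u - v)" if "i \<in> {1..m}" "\<omega> \<in> space M" for i \<omega>
      using that measurable_space[OF sample_measurable[OF k(1)]] b by (intro noise_diff_bound uv) auto
    note orth = P.expectation_norm_sum_indep_le[OF _ 1 2 3, simplified]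
    have sc: "(norm (?D u v \<omega>))\<^sup>2 = 1 / (real m)\<^sup>2 * (norm (\<Sum>i=1..m. ?W i \<omega>))\<^sup>2" for \<omega>
      by (simp add: power_divide)
    have "1 / (real m)\<^sup>2 * (\<integral>\<omega>. (norm (\<Sum>i=1..m. ?W i \<omega>))\<^sup>2 \<partial>M) \<le> 1 / (real m)\<^sup>2 * (real m * (2 * L * norm (u - v))\<^sup>2)"
      using orth(2) by (intro mult_left_mono) auto
    also have "\<dots> = 4 * L\<^sup>2 / real m * (norm (u - v))\<^sup>2"
      using params_pos(3) by (simp add: power2_eq_square field_simps)
    finally show ?thesis
      unfolding sc using orth(1) by simp
  qed
  have hV: "?h (?U \<omega>', ?V \<omega>) = (norm (?D (x k \<omega>) (x n \<omega>) \<omega>'))\<^sup>2"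
    if "\<omega> \<in> space M" for \<omega> \<omega>'
    using that k(1) n1 proj_x[of k \<omega>] proj_x[of n \<omega>] by (simp cong: sum.cong_simp)
  have inner: "integrable M (\<lambda>\<omega>'. ?h (?U \<omega>', ?V \<omega>))" "(\<integral>\<omega>'. ?h (?U \<omega>', ?V \<omega>) \<partial>M) \<le> ?b \<omega>" if "\<omega> \<in> space M" for \<omega>
    using avg[OF x_in_X[of k \<omega>] x_in_X[of n \<omega>]] that k(1) n1 by (simp_all only: hV[OF that]) auto
  have ib: "integrable M ?b" using int(2) by simp
  have "integrable M (\<lambda>\<omega>. ?h (?U \<omega>, ?V \<omega>))" "(\<integral>\<omega>. ?h (?U \<omega>, ?V \<omega>) \<partial>M) \<le> (\<integral>\<omega>. ?b \<omega> \<partial>M)"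
    using inner by (intro P.indep_rv_integral_le[OF ind h _ _ _ ib]; simp)+
  then have D: "integrable M (\<lambda>\<omega>. (norm (?D (x k \<omega>) (x n \<omega>) \<omega>))\<^sup>2)"
    "(\<integral>\<omega>. (norm (?D (x k \<omega>) (x n \<omega>) \<omega>))\<^sup>2 \<partial>M) \<le> (\<integral>\<omega>. ?b \<omega> \<partial>M)"
    by (simp_all only: hV cong: Bochner_Integration.integrable_cong Bochner_Integration.integral_cong)
  let ?r = "\<lambda>\<omega>. 2 * (norm (?D (x k \<omega>) (x n \<omega>) \<omega>))\<^sup>2 + 2 * (infnorm (err n \<omega>))\<^sup>2"
  have le: "(infnorm (err k \<omega>))\<^sup>2 \<le> ?r \<omega>" if "\<omega> \<in> space M" for \<omega>
  proof -
    let ?a = "norm (?D (x k \<omega>) (x n \<omega>) \<omega>)" and ?e = "infnorm (err n \<omega>)"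
    have "infnorm (err k \<omega>) \<le> ?a + ?e"
      using err_in_block[OF k that] infnorm_triangle[of "?D (x k \<omega>) (x n \<omega>) \<omega>" "err n \<omega>"]
        infnorm_le_norm[of "?D (x k \<omega>) (x n \<omega>) \<omega>"] n by simp
    then have "(infnorm (err k \<omega>))\<^sup>2 \<le> (?a + ?e)\<^sup>2" by (intro power_mono infnorm_pos_le)
    also have "\<dots> \<le> ?r \<omega>" using sum_squares_bound[of ?a ?e] unfolding power2_sum by linarith
    finally show ?thesis .
  qed
  have ir: "integrable M ?r" using D(1) int(1) by simp
  note [measurable] = err_measurable[OF k(1)]
  show ie: "integrable M (\<lambda>\<omega>. (infnorm (err k \<omega>))\<^sup>2)"
    by (rule Bochner_Integration.integrable_bound[OF ir]) (use le in \<open>auto intro!: AE_I2 order_trans[OF le]\<close>)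
  have "(\<integral>\<omega>. (infnorm (err k \<omega>))\<^sup>2 \<partial>M) \<le> (\<integral>\<omega>. ?r \<omega> \<partial>M)"
    using ie ir le by (rule integral_mono)
  also have "\<dots> = 2 * (\<integral>\<omega>. (norm (?D (x k \<omega>) (x n \<omega>) \<omega>))\<^sup>2 \<partial>M) + 2 * (\<integral>\<omega>. (infnorm (err n \<omega>))\<^sup>2 \<partial>M)"
    using D(1) int(1) by simp
  finally show "(\<integral>\<omega>. (infnorm (err k \<omega>))\<^sup>2 \<partial>M) \<le> 2 * (\<integral>\<omega>. (infnorm (err n \<omega>))\<^sup>2 \<partial>M)
      + 8 * L\<^sup>2 / real m * (\<integral>\<omega>. (norm (x k \<omega> - x n \<omega>))\<^sup>2 \<partial>M)"
    using D(2) by simp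
qed

text \<open>The index \<open>Y\<close> is independent of the iterates. Averaging it out for frozen iterates turns the value at
the random index into the mean over all iterations.\<close>

lemma output_expectation:
  fixes h :: "real ^ 'd \<Rightarrow> real"
  assumes h[measurable]: "h \<in> borel_measurable borel" and h0: "\<And>u. 0 \<le> h u"
    and int: "\<And>k. k \<in> {1..K} \<Longrightarrow> integrable M (\<lambda>\<omega>. h (x (k + 1) \<omega>))"
  shows "integrable M (\<lambda>\<omega>. h (x (Y \<omega> + 1) \<omega>))"
    "(\<integral>\<omega>. h (x (Y \<omega> + 1) \<omega>) \<partial>M) \<le> (\<Sum>k=1..K. \<integral>\<omega>. h (x (k + 1) \<omega>) \<partial>M) / real K"
proof -
  let ?S = "count_space {1..K}"
  let ?T = "(\<Pi>\<^sub>M j\<in>{1..K + 1}. borel) \<Otimes>\<^sub>M (\<Pi>\<^sub>M p\<in>sample_index K q m m1. D) :: ((nat \<Rightarrow> real ^ 'd) \<times> (nat \<times> nat \<Rightarrow> 'z)) measure"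
  let ?V = "\<lambda>\<omega>. (\<lambda>j\<in>{1..K + 1}. x j \<omega>, \<lambda>p\<in>sample_index K q m m1. \<zeta> (fst p) (snd p) \<omega>)"
  let ?h = "\<lambda>p. h (fst (snd p) (fst p + 1))"
  let ?b = "\<lambda>\<omega>. (\<Sum>k=1..K. h (x (k + 1) \<omega>)) / real K"
  have hm: "?h \<in> borel_measurable (?S \<Otimes>\<^sub>M ?T)"
  proof (rule measurable_compose_countable'[where g=fst and I="{1..K}" and f="\<lambda>i p. h (fst (snd p) (i + 1))"])
    fix i assume "i \<in> {1..K}"
    then show "(\<lambda>p. h (fst (snd p) (i + 1))) \<in> borel_measurable (?S \<Otimes>\<^sub>M ?T)"
      by (intro measurable_compose[OF _ h] measurable_compose[OF measurable_snd]
          measurable_compose[OF measurable_fst] measurable_component_singleton) auto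
  qed auto
  have Yr: "Y \<omega> \<in> {1..K}" if "\<omega> \<in> space M" for \<omega>
    using measurable_space[OF Y_uniform(1) that] by simp
  have hV: "?h (Y \<omega>', ?V \<omega>) = (\<Sum>k=1..K. indicator {\<omega> \<in> space M. Y \<omega> = k} \<omega>' * h (x (k + 1) \<omega>))"
    if "\<omega>' \<in> space M" for \<omega> \<omega>'
  proof -
    have "(\<Sum>k=1..K. indicator {\<omega> \<in> space M. Y \<omega> = k} \<omega>' * h (x (k + 1) \<omega>))
        = (\<Sum>k=1..K. if k = Y \<omega>' then h (x (k + 1) \<omega>) else 0)"
      using that by (intro sum.cong) (auto simp: indicator_def)
    then show ?thesis using Yr[OF that] by simp
  qed
  have ev: "{\<omega> \<in> space M. Y \<omega> = k} \<in> P.events" if "k \<in> {1..K}" for k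
    using measurable_sets[OF Y_uniform(1), of "{k}"] that by (simp add: vimage_def Int_def conj_commute)
  have inner: "has_bochner_integral M (\<lambda>\<omega>'. ?h (Y \<omega>', ?V \<omega>)) (?b \<omega>)" for \<omega>
  proof -
    have "has_bochner_integral M (\<lambda>\<omega>'. \<Sum>k=1..K. indicator {\<omega> \<in> space M. Y \<omega> = k} \<omega>' * h (x (k + 1) \<omega>))
        (\<Sum>k=1..K. P.prob {\<omega> \<in> space M. Y \<omega> = k} * h (x (k + 1) \<omega>))"
      using ev by (intro has_bochner_integral_sum has_bochner_integral_mult_left has_bochner_integral_real_indicator)
        (auto simp: P.emeasure_eq_measure)
    also have "(\<Sum>k=1..K. P.prob {\<omega> \<in> space M. Y \<omega> = k} * h (x (k + 1) \<omega>)) = ?b \<omega>"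
      by (simp add: Y_uniform(2) sum_divide_distrib)
    finally show ?thesis using hV by (simp cong: has_bochner_integral_cong)
  qed
  have ib: "integrable M ?b" using int by (intro integrable_divide Bochner_Integration.integrable_sum) auto
  note bnd = P.indep_rv_integral_le[OF Y_indep hm _ _ _ ib]
  have "integrable M (\<lambda>\<omega>. ?h (Y \<omega>, ?V \<omega>))" "(\<integral>\<omega>. ?h (Y \<omega>, ?V \<omega>) \<partial>M) \<le> (\<integral>\<omega>. ?b \<omega> \<partial>M)"
    using inner h0 by (intro bnd; auto simp: has_bochner_integral_iff)+
  moreover have "?h (Y \<omega>, ?V \<omega>) = h (x (Y \<omega> + 1) \<omega>)" if "\<omega> \<in> space M" for \<omega>
    using Yr[OF that] by simp
  ultimately show "integrable M (\<lambda>\<omega>. h (x (Y \<omega> + 1) \<omega>))"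
    "(\<integral>\<omega>. h (x (Y \<omega> + 1) \<omega>) \<partial>M) \<le> (\<Sum>k=1..K. \<integral>\<omega>. h (x (k + 1) \<omega>) \<partial>M) / real K"
    using int by (simp_all cong: Bochner_Integration.integrable_cong Bochner_Integration.integral_cong)
qed

end

section \<open>Descent along a run\<close>

lemma norm_sum_power2_le:
  fixes a :: "nat \<Rightarrow> 'b::real_normed_vector"
  shows "(norm (\<Sum>j\<in>I. a j))\<^sup>2 \<le> real (card I) * (\<Sum>j\<in>I. (norm (a j))\<^sup>2)"
proof -
  have "(norm (\<Sum>j\<in>I. a j))\<^sup>2 \<le> (\<Sum>j\<in>I. norm (a j))\<^sup>2"
    by (intro power_mono norm_sum) simp
  also have "\<dots> \<le> (\<Sum>j\<in>I. (norm (a j))\<^sup>2) * card I"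
    by (rule sum_squared_le_sum_of_squares)
  finally show ?thesis by (simp add: mult.commute)
qed

text \<open>From here on the step size is \<open>1 / L\<close> and the weight of the distance term is 128. In the descent
inequality this weight leaves a multiple of the squared step that exceeds the one which the error of
the gradient estimate contributes once the batches inside a block have size \<open>q\<^sup>2\<close>.\<close>

locale disfom_l1_run =
  disfom_vr_run D F X L \<sigma> f_low M "dist_term 128" "1 / L" \<epsilon>h K q m m1 \<zeta> x G Y
  for D :: "'z measure" and F :: "real ^ 'd \<Rightarrow> 'z \<Rightarrow> real" and X :: "(real ^ 'd) set"
    and L \<sigma> f_low :: real and M :: "'w measure"
    and \<epsilon>h :: real and K q m m1 :: nat
    and \<zeta> :: "nat \<Rightarrow> nat \<Rightarrow> 'w \<Rightarrow> 'z" and x G :: "nat \<Rightarrow> 'w \<Rightarrow> real ^ 'd" and Y :: "'w \<Rightarrow> nat" +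
  fixes c :: real
  assumes averaging: "averaging_constant TYPE('w) TYPE('d) c"
begin

definition err_sq :: "nat \<Rightarrow> 'w \<Rightarrow> real" where "err_sq k \<omega> = (infnorm (err k \<omega>))\<^sup>2"

definition step_sq :: "nat \<Rightarrow> 'w \<Rightarrow> real" where "step_sq k \<omega> = (l1norm (x (k + 1) \<omega> - x k \<omega>))\<^sup>2"

text \<open>The smoothness term \<open>L / 2 * (norm s)\<^sup>2\<close> cancels against the proximal term. The error enters only
through its product with the step, which is split by Young's inequality between \<open>err_sq\<close> and an
eighth of the decrease \<open>32 * L * step_sq\<close>.\<close>

lemma one_step_descent:
  assumes k: "k \<in> {1..K}" and \<omega>: "\<omega> \<in> space M"
  shows "f (x (k + 1) \<omega>) \<le> f (x k \<omega>) + err_sq k \<omega> / (16 * L) - 28 * L * step_sq k \<omega> + 257 / 2 * L * \<epsilon>h\<^sup>2"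
proof -
  let ?x = "x k \<omega>" and ?x' = "x (k + 1) \<omega>" and ?g = "G k \<omega>"
  have X: "?x \<in> X" "?x' \<in> X" using x_in_X k \<omega> by auto
  define s where "s = ?x' - ?x"
  have "f ?x' \<le> f ?x + gradient f ?x \<bullet> s + L / 2 * (norm s)\<^sup>2"
    unfolding s_def by (rule descent_lemma[OF f_differentiable X_convex X gradient_Lipschitz])
  moreover have "gradient f ?x \<bullet> s = ?g \<bullet> s - err k \<omega> \<bullet> s"
    by (simp add: err_def inner_diff_left)
  moreover have "- (err k \<omega> \<bullet> s) \<le> infnorm (err k \<omega>) * l1norm s"
    using inner_le_infnorm_l1norm[of "err k \<omega>" s] by linarith
  moreover have "infnorm (err k \<omega>) * l1norm s \<le> err_sq k \<omega> / (16 * L) + 4 * L * step_sq k \<omega>"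
  proof -
    have "0 \<le> (infnorm (err k \<omega>) - 8 * L * l1norm s)\<^sup>2" by simp
    also have "\<dots> = err_sq k \<omega> - 16 * L * (infnorm (err k \<omega>) * l1norm s) + 64 * L\<^sup>2 * step_sq k \<omega>"
      by (simp add: err_sq_def step_sq_def s_def power2_eq_square algebra_simps)
    finally have "16 * L * (infnorm (err k \<omega>) * l1norm s) \<le> err_sq k \<omega> + 64 * L\<^sup>2 * step_sq k \<omega>" by simp
    then show ?thesis using L_pos by (simp add: field_simps power2_eq_square)
  qed
  moreover have "?g \<bullet> s \<le> - L / 2 * (norm s)\<^sup>2 - 32 * L * step_sq k \<omega> + 257 / 2 * L * \<epsilon>h\<^sup>2"
  proof -
    have "1 / L * (?g \<bullet> s) \<le> - (norm s)\<^sup>2 / 2 - 128 / 4 * step_sq k \<omega> + (128 + 1 / 2) * \<epsilon>h\<^sup>2"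
      unfolding s_def step_sq_def
      by (rule inexact_prox_step_inner[OF step[OF k \<omega>] X(1)]) (use params_pos in auto)
    then show ?thesis using L_pos by (simp add: field_simps)
  qed
  ultimately show ?thesis by linarith
qed

lemma iterate_distance:
  assumes k: "k \<in> {1..K}" and n: "n = block_start q k" and \<omega>: "\<omega> \<in> space M"
  shows "(norm (x k \<omega> - x n \<omega>))\<^sup>2 \<le> real q * (\<Sum>j\<in>{n..<k}. step_sq j \<omega>)"
proof -
  have nk: "n \<le> k" "k - n \<le> q" using block_start_props[of k] k n by auto
  have "x k \<omega> - x n \<omega> = (\<Sum>j\<in>{n..<k}. x (j + 1) \<omega> - x j \<omega>)"
    using sum_Suc_diff'[OF nk(1), of "\<lambda>j. x j \<omega>"] by simp
  then have "(norm (x k \<omega> - x n \<omega>))\<^sup>2 \<le> real (k - n) * (\<Sum>j\<in>{n..<k}. (norm (x (j + 1) \<omega> - x j \<omega>))\<^sup>2)"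
    using norm_sum_power2_le[of "\<lambda>j. x (j + 1) \<omega> - x j \<omega>" "{n..<k}"] by simp
  also have "\<dots> \<le> real q * (\<Sum>j\<in>{n..<k}. step_sq j \<omega>)"
    using nk(2) by (intro mult_mono sum_mono sum_nonneg)
      (auto simp: step_sq_def intro!: power_mono norm_le_l1norm)
  finally show ?thesis .
qed

text \<open>The moment bounds at a block start and inside a block are combined, with the distance to the block
start expressed through the steps made since then. Only steps before iteration \<open>k\<close> occur, so the
lemma can be used in an induction that has their integrability for earlier iterations.\<close>

lemma err_sq_recursion:
  assumes k: "k \<in> {1..K}" and s: "\<And>j. j \<in> {1..<k} \<Longrightarrow> integrable M (step_sq j)"
  shows "integrable M (err_sq k)"
    "(\<integral>\<omega>. err_sq k \<omega> \<partial>M) \<le> 2 * (c * ln (real CARD('d)) * \<sigma>\<^sup>2 / real m1)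
      + 8 * L\<^sup>2 * real q / real m * (\<Sum>j\<in>{block_start q k..<k}. \<integral>\<omega>. step_sq j \<omega> \<partial>M)"
proof -
  define n where "n = block_start q k"
  have n: "n \<in> {1..K}" "n = block_start q n" "n \<le> k" using block_start_props[of k] k by (auto simp: n_def)
  let ?B = "c * ln (real CARD('d)) * \<sigma>\<^sup>2 / real m1"
  have en: "integrable M (err_sq n)" "(\<integral>\<omega>. err_sq n \<omega> \<partial>M) \<le> ?B"
    using block_start_err_bound[OF averaging n(1,2)] by (auto simp: err_sq_def[abs_def])
  have "0 \<le> (\<integral>\<omega>. err_sq n \<omega> \<partial>M)" by (simp add: err_sq_def)
  with en(2) have B0: "0 \<le> ?B" by linarith
  let ?d = "\<lambda>\<omega>. (norm (x k \<omega> - x n \<omega>))\<^sup>2"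
  have s': "integrable M (step_sq j)" if "j \<in> {n..<k}" for j using s that n(1) by auto
  have rs: "integrable M (\<lambda>\<omega>. real q * (\<Sum>j\<in>{n..<k}. step_sq j \<omega>))"
    by (intro integrable_mult_right Bochner_Integration.integrable_sum s')
  have [measurable]: "x k \<in> borel_measurable M" "x n \<in> borel_measurable M"
    using k n x_measurable by auto
  have d: "integrable M ?d"
    by (rule Bochner_Integration.integrable_bound[OF rs])
      (use iterate_distance[OF k n_def] in \<open>auto intro!: AE_I2 intro: order_trans[OF _ abs_ge_self]\<close>)
  have "(\<integral>\<omega>. ?d \<omega> \<partial>M) \<le> (\<integral>\<omega>. real q * (\<Sum>j\<in>{n..<k}. step_sq j \<omega>) \<partial>M)"
    using d rs iterate_distance[OF k n_def] by (rule integral_mono)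
  also have "\<dots> = real q * (\<Sum>j\<in>{n..<k}. \<integral>\<omega>. step_sq j \<omega> \<partial>M)"
    using s' by (simp add: Bochner_Integration.integral_sum)
  finally have dle: "8 * L\<^sup>2 / real m * (\<integral>\<omega>. ?d \<omega> \<partial>M) \<le> 8 * L\<^sup>2 / real m * (real q * (\<Sum>j\<in>{n..<k}. \<integral>\<omega>. step_sq j \<omega> \<partial>M))"
    by (intro mult_left_mono) auto
  have "integrable M (err_sq k) \<and> (\<integral>\<omega>. err_sq k \<omega> \<partial>M) \<le> 2 * ?B
      + 8 * L\<^sup>2 * real q / real m * (\<Sum>j\<in>{n..<k}. \<integral>\<omega>. step_sq j \<omega> \<partial>M)"
  proof (cases "k = n")
    case True
    have "(\<integral>\<omega>. err_sq k \<omega> \<partial>M) \<le> 2 * ?B" unfolding True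
      using en(2) B0 by (simp only: mult_2)
    then show ?thesis using en(1) True by simp
  next
    case False
    note ib = in_block_err_bound[OF k False[unfolded n_def] n_def en(1)[unfolded err_sq_def] d]
    have "(\<integral>\<omega>. err_sq k \<omega> \<partial>M) \<le> 2 * (\<integral>\<omega>. err_sq n \<omega> \<partial>M) + 8 * L\<^sup>2 / real m * (\<integral>\<omega>. ?d \<omega> \<partial>M)"
      using ib(2) by (simp add: err_sq_def)
    also have "\<dots> \<le> 2 * ?B + 8 * L\<^sup>2 / real m * (real q * (\<Sum>j\<in>{n..<k}. \<integral>\<omega>. step_sq j \<omega> \<partial>M))"
      using en(2) dle by linarith
    finally show ?thesis using ib(1) by (simp add: err_sq_def[abs_def] mult.assoc)
  qed
  then show "integrable M (err_sq k)" "(\<integral>\<omega>. err_sq k \<omega> \<partial>M) \<le> 2 * ?B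
      + 8 * L\<^sup>2 * real q / real m * (\<Sum>j\<in>{block_start q k..<k}. \<integral>\<omega>. step_sq j \<omega> \<partial>M)"
    by (simp_all add: n_def)
qed

text \<open>Only the initial objective value is known to be integrable. The descent inequality carries
integrability from one iteration to the next: the new objective value and the squared step, both
bounded below, have a sum that is dominated by integrable quantities.\<close>

lemma iterates_integrable:
  "k \<le> K \<Longrightarrow> integrable M (\<lambda>\<omega>. f (x (k + 1) \<omega>)) \<and> (\<forall>j\<in>{1..k}. integrable M (err_sq j) \<and> integrable M (step_sq j))"
proof (induction k)
  case 0
  then show ?case using f_x1_integrable by simp
next
  case (Suc k)
  let ?k = "Suc k"
  have k: "?k \<in> {1..K}" using Suc.prems by simp
  have IH: "integrable M (\<lambda>\<omega>. f (x ?k \<omega>))" "\<And>j. j \<in> {1..k} \<Longrightarrow> integrable M (err_sq j) \<and> integrable M (step_sq j)"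
    using Suc by auto
  have e: "integrable M (err_sq ?k)"
    using IH(2) by (intro err_sq_recursion[OF k]) auto
  have [measurable]: "x ?k \<in> borel_measurable M" "x (?k + 1) \<in> borel_measurable M"
    using k by (auto intro!: x_measurable)
  let ?u = "\<lambda>\<omega>. f (x ?k \<omega>) + err_sq ?k \<omega> / (16 * L) + 257 / 2 * L * \<epsilon>h\<^sup>2"
  have u: "integrable M ?u" using IH(1) e by simp
  have step: "f (x (?k + 1) \<omega>) + 28 * L * step_sq ?k \<omega> \<le> ?u \<omega>" if "\<omega> \<in> space M" for \<omega>
    using one_step_descent[OF k that] by linarith
  have low: "f_low \<le> f (x (?k + 1) \<omega>)" if "\<omega> \<in> space M" for \<omega>
    using k that by (intro f_bounded_below x_in_X) auto
  have s0: "0 \<le> 28 * L * step_sq ?k \<omega>" for \<omega> using L_pos by (simp add: step_sq_def)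
  have "integrable M (\<lambda>\<omega>. f (x (?k + 1) \<omega>))"
  proof (rule Bochner_Integration.integrable_bound[where f="\<lambda>\<omega>. \<bar>?u \<omega>\<bar> + \<bar>f_low\<bar>"])
    show "AE \<omega> in M. norm (f (x (?k + 1) \<omega>)) \<le> norm (\<bar>?u \<omega>\<bar> + \<bar>f_low\<bar>)"
    proof (rule AE_I2)
      fix \<omega> assume "\<omega> \<in> space M"
      from step[OF this] low[OF this] s0[of \<omega>]
      show "norm (f (x (?k + 1) \<omega>)) \<le> norm (\<bar>?u \<omega>\<bar> + \<bar>f_low\<bar>)" by (auto simp: abs_if)
    qed
    show "(\<lambda>\<omega>. f (x (?k + 1) \<omega>)) \<in> borel_measurable M"
      by (rule measurable_compose[OF _ objective_measurable]) fact
  qed (use u in auto)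
  moreover have "integrable M (\<lambda>\<omega>. 28 * L * step_sq ?k \<omega>)"
  proof (rule Bochner_Integration.integrable_bound[where f="\<lambda>\<omega>. ?u \<omega> - f_low"])
    show "AE \<omega> in M. norm (28 * L * step_sq ?k \<omega>) \<le> norm (?u \<omega> - f_low)"
    proof (rule AE_I2)
      fix \<omega> assume "\<omega> \<in> space M"
      from step[OF this] low[OF this] s0[of \<omega>]
      show "norm (28 * L * step_sq ?k \<omega>) \<le> norm (?u \<omega> - f_low)" by (auto simp: abs_if)
    qed
    show "(\<lambda>\<omega>. 28 * L * step_sq ?k \<omega>) \<in> borel_measurable M"
      unfolding step_sq_def by measurable
  qed (use u in auto)
  then have "integrable M (step_sq ?k)" using L_pos by (simp add: integrable_mult_right_iff)
  ultimately show ?case using e IH(2) by (auto simp: le_Suc_eq)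
qed

lemma objective_integrable: "k \<in> {1..K + 1} \<Longrightarrow> integrable M (\<lambda>\<omega>. f (x k \<omega>))"
  using iterates_integrable[of "k - 1"] by (cases k) simp_all

lemma step_sq_integrable: "k \<in> {1..K} \<Longrightarrow> integrable M (step_sq k)"
  and err_sq_integrable: "k \<in> {1..K} \<Longrightarrow> integrable M (err_sq k)"
  using iterates_integrable[of K] by auto

text \<open>A step made at iteration \<open>j\<close> counts only in later iterations of the same block, of which there are
fewer than \<open>q\<close>.\<close>

lemma sum_block_prefixes:
  fixes a :: "nat \<Rightarrow> real"
  assumes "\<And>j. 0 \<le> a j"
  shows "(\<Sum>k=1..K. \<Sum>j\<in>{block_start q k..<k}. a j) \<le> real q * (\<Sum>j=1..K. a j)"
proof -
  have "(\<Sum>k=1..K. \<Sum>j\<in>{block_start q k..<k}. a j) \<le> (\<Sum>k=1..K. \<Sum>j=1..K. if k \<in> {j<..<j + q} then a j else 0)"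
  proof (rule sum_mono)
    fix k assume k: "k \<in> {1..K}"
    have sub: "{block_start q k..<k} \<subseteq> {j \<in> {1..K}. k \<in> {j<..<j + q}}"
      using block_start_props[of k] k by auto
    have "(\<Sum>j\<in>{block_start q k..<k}. a j) \<le> (\<Sum>j | j \<in> {1..K} \<and> k \<in> {j<..<j + q}. a j)"
      using sub assms by (intro sum_mono2) auto
    then show "(\<Sum>j\<in>{block_start q k..<k}. a j) \<le> (\<Sum>j=1..K. if k \<in> {j<..<j + q} then a j else 0)"
      by (subst (asm) sum.inter_filter) auto
  qed
  also have "\<dots> = (\<Sum>j=1..K. \<Sum>k=1..K. if k \<in> {j<..<j + q} then a j else 0)"
    by (rule sum.swap)
  also have "\<dots> = (\<Sum>j=1..K. real (card {k \<in> {1..K}. k \<in> {j<..<j + q}}) * a j)"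
    by (subst sum.inter_filter[symmetric]) auto
  also have "\<dots> \<le> (\<Sum>j=1..K. real q * a j)"
  proof (intro sum_mono mult_right_mono assms)
    fix j
    have "card {k \<in> {1..K}. k \<in> {j<..<j + q}} \<le> card {j<..<j + q}" by (intro card_mono) auto
    then show "real (card {k \<in> {1..K}. k \<in> {j<..<j + q}}) \<le> real q" by simp
  qed
  finally show ?thesis by (simp add: sum_distrib_left)
qed

lemma total_error:
  "(\<Sum>k=1..K. \<integral>\<omega>. err_sq k \<omega> \<partial>M) \<le> 2 * real K * (c * ln (real CARD('d)) * \<sigma>\<^sup>2 / real m1)
    + 8 * L\<^sup>2 * (real q)\<^sup>2 / real m * (\<Sum>k=1..K. \<integral>\<omega>. step_sq k \<omega> \<partial>M)"
proof -
  let ?B = "c * ln (real CARD('d)) * \<sigma>\<^sup>2 / real m1" and ?S = "\<lambda>j. \<integral>\<omega>. step_sq j \<omega> \<partial>M"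
  let ?a = "8 * L\<^sup>2 * real q / real m"
  have S0: "0 \<le> ?S j" for j by (simp add: step_sq_def)
  have "(\<Sum>k=1..K. \<integral>\<omega>. err_sq k \<omega> \<partial>M) \<le> (\<Sum>k=1..K. 2 * ?B + ?a * (\<Sum>j\<in>{block_start q k..<k}. ?S j))"
    by (intro sum_mono err_sq_recursion step_sq_integrable) auto
  also have "\<dots> = 2 * real K * ?B + ?a * (\<Sum>k=1..K. \<Sum>j\<in>{block_start q k..<k}. ?S j)"
    by (simp add: sum.distrib sum_distrib_left)
  also have "\<dots> \<le> 2 * real K * ?B + ?a * (real q * (\<Sum>k=1..K. ?S k))"
    by (intro add_left_mono mult_left_mono sum_block_prefixes S0) simp
  finally show ?thesis by (simp add: power2_eq_square mult.assoc)
qed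

text \<open>The expectations of the objective telescope in \<open>one_step_descent\<close>, and the last one is at least
\<open>f_low\<close>.\<close>

lemma total_steps:
  "28 * L * (\<Sum>k=1..K. \<integral>\<omega>. step_sq k \<omega> \<partial>M) \<le> (\<integral>\<omega>. f (x 1 \<omega>) \<partial>M) - f_low
    + (\<Sum>k=1..K. \<integral>\<omega>. err_sq k \<omega> \<partial>M) / (16 * L) + 257 / 2 * real K * L * \<epsilon>h\<^sup>2"
proof -
  let ?E = "\<lambda>k. \<integral>\<omega>. f (x k \<omega>) \<partial>M"
  let ?D = "257 / 2 * L * \<epsilon>h\<^sup>2"
  have one: "28 * L * (\<integral>\<omega>. step_sq k \<omega> \<partial>M) \<le> (?E k - ?E (Suc k)) + ((\<integral>\<omega>. err_sq k \<omega> \<partial>M) / (16 * L) + ?D)"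
    if k: "k \<in> {1..K}" for k
  proof -
    note [simp] = step_sq_integrable[OF k] err_sq_integrable[OF k]
    have fi: "integrable M (\<lambda>\<omega>. f (x k \<omega>))" "integrable M (\<lambda>\<omega>. f (x (k + 1) \<omega>))"
      using k by (auto intro!: objective_integrable)
    have "(\<integral>\<omega>. 28 * L * step_sq k \<omega> \<partial>M) \<le> (\<integral>\<omega>. f (x k \<omega>) - f (x (k + 1) \<omega>) + (err_sq k \<omega> / (16 * L) + ?D) \<partial>M)"
      using fi one_step_descent[OF k] by (intro integral_mono) (auto simp: algebra_simps)
    also have "\<dots> = (?E k - ?E (Suc k)) + ((\<integral>\<omega>. err_sq k \<omega> \<partial>M) / (16 * L) + ?D)"
      using fi by (simp add: P.prob_space)
    finally show ?thesis by simp
  qed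
  have "28 * L * (\<Sum>k=1..K. \<integral>\<omega>. step_sq k \<omega> \<partial>M) = (\<Sum>k=1..K. 28 * L * (\<integral>\<omega>. step_sq k \<omega> \<partial>M))"
    by (rule sum_distrib_left)
  also have "\<dots> \<le> (\<Sum>k=1..K. (?E k - ?E (Suc k)) + ((\<integral>\<omega>. err_sq k \<omega> \<partial>M) / (16 * L) + ?D))"
    by (intro sum_mono one)
  also have "\<dots> = (\<Sum>k=1..K. ?E k - ?E (Suc k)) + (\<Sum>k=1..K. \<integral>\<omega>. err_sq k \<omega> \<partial>M) / (16 * L) + real K * ?D"
    by (simp add: sum.distrib sum_divide_distrib)
  also have "(\<Sum>k=1..K. ?E k - ?E (Suc k)) = ?E 1 - ?E (K + 1)"
    using sum_Suc_diff[of 1 K "\<lambda>k. - ?E k"] params_pos(1) by simp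
  finally have "28 * L * (\<Sum>k=1..K. \<integral>\<omega>. step_sq k \<omega> \<partial>M) \<le> ?E 1 - ?E (K + 1)
      + (\<Sum>k=1..K. \<integral>\<omega>. err_sq k \<omega> \<partial>M) / (16 * L) + real K * ?D" .
  moreover have "f_low \<le> ?E (K + 1)"
  proof -
    have "(\<integral>\<omega>. f_low \<partial>M) \<le> ?E (K + 1)"
      by (intro integral_mono objective_integrable f_bounded_below x_in_X) auto
    then show ?thesis by (simp add: P.prob_space)
  qed
  ultimately show ?thesis by simp
qed

text \<open>The distance to stationarity is linear in the error and in the step, while the available bounds
concern their squares. Young's inequality with weights proportional to \<open>\<epsilon>\<close> converts one into the
other, so that no square roots of expectations are needed.\<close>

lemma stationarity_of_step:
  assumes k: "k \<in> {1..K}" and \<omega>: "\<omega> \<in> space M" and \<epsilon>: "\<epsilon> > 0"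
  shows "dist_inf_zero (constrained_subdiff f X (x (k + 1) \<omega>))
    \<le> err_sq k \<omega> / (14 * \<epsilon>) + 130 * L\<^sup>2 / (4 * \<epsilon>) * step_sq k \<omega> + (7 / 2 * \<epsilon> + 130 * \<epsilon> + 129 * L * \<epsilon>h)"
proof -
  let ?s = "l1norm (x (k + 1) \<omega> - x k \<omega>)" and ?e = "infnorm (err k \<omega>)"
  have X: "x k \<omega> \<in> X" "x (k + 1) \<omega> \<in> X" using x_in_X k \<omega> by auto
  have "dist_inf_zero (constrained_subdiff f X (x (k + 1) \<omega>)) \<le> ?e + (128 + 2) * L * ?s + (128 + 1) * L * \<epsilon>h"
    unfolding err_def
    by (rule dist_after_inexact_prox_step[OF step[OF k \<omega>] X(1) _ L_pos gradient_Lipschitz[OF X(2,1)]]) simp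
  moreover have "?e \<le> err_sq k \<omega> / (14 * \<epsilon>) + 7 / 2 * \<epsilon>"
    using sum_squares_bound[of ?e "7 * \<epsilon>"] \<epsilon> by (simp add: err_sq_def field_simps power2_eq_square)
  moreover have "L * ?s \<le> L\<^sup>2 / (4 * \<epsilon>) * step_sq k \<omega> + \<epsilon>"
    using sum_squares_bound[of "L * ?s" "2 * \<epsilon>"] \<epsilon> by (simp add: step_sq_def field_simps power2_eq_square)
  ultimately show ?thesis by simp
qed

text \<open>\<open>total_error\<close> and \<open>total_steps\<close> bound the summed squared errors \<open>E\<close> and the summed squared steps \<open>S\<close>
by each other. In units of \<open>R = K * \<epsilon>\<^sup>2\<close> they read \<open>E \<le> 2 * R + 8 * L\<^sup>2 * S\<close> and
\<open>28 * L\<^sup>2 * S \<le> 130 * R + E / 16\<close>, so eliminating \<open>E\<close> takes back only \<open>L\<^sup>2 * S / 2\<close> of the left-hand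
side of the second.\<close>

lemma expected_stationarity:
  assumes \<epsilon>: "\<epsilon> > 0" and \<epsilon>h: "\<epsilon>h = \<epsilon> / L"
    and m1: "c * ln (real CARD('d)) * \<sigma>\<^sup>2 / real m1 \<le> \<epsilon>\<^sup>2" and m: "m = q\<^sup>2"
    and K: "((\<integral>\<omega>. f (x 1 \<omega>) \<partial>M) - f_low) * L \<le> real K * \<epsilon>\<^sup>2"
  shows "integrable M (\<lambda>\<omega>. dist_inf_zero (constrained_subdiff f X (x (Y \<omega> + 1) \<omega>)))"
    "(\<integral>\<omega>. dist_inf_zero (constrained_subdiff f X (x (Y \<omega> + 1) \<omega>)) \<partial>M) \<le> 1000 * \<epsilon>"
proof -
  define E where "E = (\<Sum>k=1..K. \<integral>\<omega>. err_sq k \<omega> \<partial>M)"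
  define S where "S = (\<Sum>k=1..K. \<integral>\<omega>. step_sq k \<omega> \<partial>M)"
  define R where "R = real K * \<epsilon>\<^sup>2"
  have q0: "real q > 0" and K0: "real K > 0" using params_pos by auto
  have S0: "0 \<le> S" unfolding S_def step_sq_def by (intro sum_nonneg) simp
  have E_le: "E \<le> 2 * R + 8 * (L\<^sup>2 * S)"
  proof -
    have "8 * L\<^sup>2 * (real q)\<^sup>2 / real m = 8 * L\<^sup>2" using q0 by (simp add: m)
    moreover have "2 * real K * (c * ln (real CARD('d)) * \<sigma>\<^sup>2 / real m1) \<le> 2 * real K * \<epsilon>\<^sup>2"
      using m1 by (intro mult_left_mono) auto
    ultimately show ?thesis using total_error by (simp add: E_def S_def R_def)
  qed
  have S_le: "L\<^sup>2 * S \<le> 5 * R"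
  proof -
    have "L * (28 * L * S) \<le> L * ((\<integral>\<omega>. f (x 1 \<omega>) \<partial>M) - f_low + E / (16 * L) + 257 / 2 * real K * L * \<epsilon>h\<^sup>2)"
      using total_steps L_pos unfolding E_def S_def by (intro mult_left_mono) auto
    also have "\<dots> = ((\<integral>\<omega>. f (x 1 \<omega>) \<partial>M) - f_low) * L + E / 16 + 257 / 2 * R"
      using L_pos by (simp add: \<epsilon>h R_def field_simps power2_eq_square)
    finally have "28 * (L\<^sup>2 * S) \<le> R + E / 16 + 257 / 2 * R"
      using K by (simp add: R_def power2_eq_square mult_ac)
    moreover have "0 \<le> R" by (simp add: R_def)
    ultimately show ?thesis using E_le by linarith
  qed
  let ?h = "\<lambda>u. dist_inf_zero (constrained_subdiff f X (proj u))"
  have h: "?h \<in> borel_measurable borel"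
    by (rule borel_measurable_dist_constrained_subdiff[OF X_convex X_closed X_nonempty gradient_continuous])
  have h0: "0 \<le> ?h u" for u by (intro dist_inf_zero_nonneg proj_in)
  let ?r = "\<lambda>k \<omega>. err_sq k \<omega> / (14 * \<epsilon>) + 130 * L\<^sup>2 / (4 * \<epsilon>) * step_sq k \<omega> + (7 / 2 * \<epsilon> + 130 * \<epsilon> + 129 * L * \<epsilon>h)"
  have r: "integrable M (?r k)" if "k \<in> {1..K}" for k
    using step_sq_integrable[OF that] err_sq_integrable[OF that] by simp
  have hr: "?h (x (k + 1) \<omega>) \<le> ?r k \<omega>" if "k \<in> {1..K}" "\<omega> \<in> space M" for k \<omega>
    using stationarity_of_step[OF that \<epsilon>] proj_x[of "k + 1" \<omega>] that by simp
  have hi: "integrable M (\<lambda>\<omega>. ?h (x (k + 1) \<omega>))" if k: "k \<in> {1..K}" for k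
  proof (rule Bochner_Integration.integrable_bound[OF r[OF k]])
    show "(\<lambda>\<omega>. ?h (x (k + 1) \<omega>)) \<in> borel_measurable M"
      using k by (intro measurable_compose[OF _ h] x_measurable) auto
    show "AE \<omega> in M. norm (?h (x (k + 1) \<omega>)) \<le> norm (?r k \<omega>)"
      using hr[OF k] h0 by (intro AE_I2) (auto intro: order_trans[OF _ abs_ge_self])
  qed
  have "(\<Sum>k=1..K. \<integral>\<omega>. ?h (x (k + 1) \<omega>) \<partial>M) \<le> (\<Sum>k=1..K. \<integral>\<omega>. ?r k \<omega> \<partial>M)"
    by (intro sum_mono integral_mono hi r hr) auto
  also have "\<dots> = (\<Sum>k=1..K. (\<integral>\<omega>. err_sq k \<omega> \<partial>M) / (14 * \<epsilon>) + 130 * L\<^sup>2 / (4 * \<epsilon>) * (\<integral>\<omega>. step_sq k \<omega> \<partial>M)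
      + (7 / 2 * \<epsilon> + 130 * \<epsilon> + 129 * L * \<epsilon>h))"
    using step_sq_integrable err_sq_integrable by (intro sum.cong refl) (simp add: P.prob_space)
  also have "\<dots> = E / (14 * \<epsilon>) + 130 * L\<^sup>2 / (4 * \<epsilon>) * S + real K * (7 / 2 * \<epsilon> + 130 * \<epsilon> + 129 * L * \<epsilon>h)"
    by (simp add: E_def S_def sum.distrib sum_divide_distrib sum_distrib_left)
  also have "129 * L * \<epsilon>h = 129 * \<epsilon>" using L_pos by (simp add: \<epsilon>h)
  finally have "(\<Sum>k=1..K. \<integral>\<omega>. ?h (x (k + 1) \<omega>) \<partial>M)
      \<le> E / (14 * \<epsilon>) + 130 / (4 * \<epsilon>) * (L\<^sup>2 * S) + real K * (525 / 2 * \<epsilon>)"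
    by simp
  \<comment> \<open>\<open>E \<le> 42 * R\<close> follows from \<open>E_le\<close> and \<open>S_le\<close>: \<open>42 = 2 + 8 * 5\<close>\<close>
  also have "\<dots> \<le> (42 * R) / (14 * \<epsilon>) + 130 / (4 * \<epsilon>) * (5 * R) + real K * (525 / 2 * \<epsilon>)"
    using E_le S_le \<epsilon> by (intro add_mono divide_right_mono mult_left_mono) auto
  also have "\<dots> \<le> real K * (1000 * \<epsilon>)"
    using \<epsilon> K0 by (simp add: R_def field_simps power2_eq_square)
  finally have bound: "(\<Sum>k=1..K. \<integral>\<omega>. ?h (x (k + 1) \<omega>) \<partial>M) / real K \<le> 1000 * \<epsilon>"
    using K0 by (simp add: pos_divide_le_eq mult.commute)
  have out: "?h (x (Y \<omega> + 1) \<omega>) = dist_inf_zero (constrained_subdiff f X (x (Y \<omega> + 1) \<omega>))"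
    if "\<omega> \<in> space M" for \<omega>
    using measurable_space[OF Y_uniform(1) that] proj_x[of "Y \<omega> + 1" \<omega>] that by simp
  note oe = output_expectation[OF h h0 hi]
  show "integrable M (\<lambda>\<omega>. dist_inf_zero (constrained_subdiff f X (x (Y \<omega> + 1) \<omega>)))"
    by (rule iffD1[OF Bochner_Integration.integrable_cong[OF refl out] oe(1)])
  have "(\<integral>\<omega>. ?h (x (Y \<omega> + 1) \<omega>) \<partial>M) = (\<integral>\<omega>. dist_inf_zero (constrained_subdiff f X (x (Y \<omega> + 1) \<omega>)) \<partial>M)"
    by (rule Bochner_Integration.integral_cong[OF refl out])
  with oe(2) bound show "(\<integral>\<omega>. dist_inf_zero (constrained_subdiff f X (x (Y \<omega> + 1) \<omega>)) \<partial>M) \<le> 1000 * \<epsilon>"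
    by linarith
qed

end

section \<open>Number of samples\<close>

lemma card_block_starts:
  assumes q: "q \<ge> 1"
  shows "card {k \<in> {1..K}. k = block_start q k} = nat \<lceil>real K / real q\<rceil>"
proof -
  let ?N = "nat \<lceil>real K / real q\<rceil>"
  have lt: "i < ?N \<longleftrightarrow> i * q < K" for i
  proof -
    have "i < ?N \<longleftrightarrow> int i < \<lceil>real K / real q\<rceil>" by linarith
    also have "\<dots> \<longleftrightarrow> real i < real K / real q" by (simp add: less_ceiling_iff)
    also have "\<dots> \<longleftrightarrow> real (i * q) < real K" using q by (simp add: pos_less_divide_eq)
    finally show ?thesis by (simp only: of_nat_less_iff)
  qed
  then have lt_set: "{..<?N} = {i. i * q < K}" by auto
  \<comment> \<open>the block with number \<open>i\<close>, counted from 0, starts at iteration \<open>i * q + 1\<close>\<close>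
  have "{k \<in> {1..K}. k = block_start q k} = (\<lambda>i. i * q + 1) ` {..<?N}"
  proof (intro equalityI subsetI)
    fix k assume k: "k \<in> {k \<in> {1..K}. k = block_start q k}"
    then have "k = (k - 1) div q * q + 1" "k \<le> K" by (auto simp: block_start_def)
    then show "k \<in> (\<lambda>i. i * q + 1) ` {..<?N}"
      unfolding lt_set by (intro image_eqI[of _ _ "(k - 1) div q"]) (auto simp del: div_mult_self_is_m)
  next
    fix k assume "k \<in> (\<lambda>i. i * q + 1) ` {..<?N}"
    then obtain i where i: "k = i * q + 1" "i * q < K" unfolding lt_set by blast
    then show "k \<in> {k \<in> {1..K}. k = block_start q k}" using q by (auto simp: block_start_def)
  qed
  moreover have "inj_on (\<lambda>i. i * q + 1) {..<?N}" using q by (auto simp: inj_on_def)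
  ultimately show ?thesis by (simp add: card_image)
qed

lemma card_sample_index_le:
  assumes q: "q \<ge> 1"
  shows "real (card (sample_index K q m m1)) \<le> real K * real m + real_of_int \<lceil>real K / real q\<rceil> * real m1"
proof -
  have "card (sample_index K q m m1) = (\<Sum>k=1..K. batch_size q m m1 k)"
    unfolding sample_index_def by simp
  also have "\<dots> \<le> (\<Sum>k=1..K. m + (if k = block_start q k then m1 else 0))"
    by (intro sum_mono) (simp add: batch_size_def)
  also have "\<dots> = K * m + card {k \<in> {1..K}. k = block_start q k} * m1"
    by (simp add: sum.distrib sum.inter_filter[symmetric])
  finally have "real (card (sample_index K q m m1)) \<le> real (K * m + nat \<lceil>real K / real q\<rceil> * m1)"
    unfolding card_block_starts[OF q] by (rule of_nat_mono)
  then show ?thesis by simp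
qed

text \<open>\<open>q\<close> is the rounded-up cube root of the real number of which \<open>m1\<close> is the ceiling; the cube of \<open>q\<close> is
an integer, so rounding that number up does not pass it.\<close>

lemma m1_choice_le_q_choice_cubed:
  assumes "A > 0" "\<epsilon> > 0"
  shows "m1_choice A \<epsilon> \<le> (q_choice A \<epsilon>) ^ 3"
proof -
  let ?a = "A / \<epsilon>\<^sup>2"
  have a0: "?a > 0" using assms by simp
  then have "?a = (?a powr (1/3)) ^ 3"
    using powr_power[of ?a "1/3" 3] assms by simp
  also have "\<dots> \<le> real (q_choice A \<epsilon>) ^ 3"
    unfolding q_choice_def by (intro power_mono real_nat_ceiling_ge) simp
  finally have "?a \<le> real ((q_choice A \<epsilon>) ^ 3)" by simp
  then show ?thesis unfolding m1_choice_def by (metis ceiling_mono ceiling_of_nat nat_int nat_mono)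
qed

text \<open>Since \<open>m1 \<le> q ^ 3\<close>, it suffices that the number of blocks is at most \<open>3 * K / q\<close>. If \<open>q \<le> K\<close>, rounding
up at most doubles \<open>K / q\<close>; otherwise there is a single block, and the hypothesis \<open>q \<le> 3 * K\<close> makes the
bound at least 1.\<close>

lemma sample_bound_simplified:
  assumes q: "q \<ge> 1" "q \<le> 3 * K" and m1: "m1 \<le> q ^ 3"
  shows "real_of_int \<lceil>real K / real q\<rceil> * real m1 \<le> 3 * real K * (real q)\<^sup>2"
proof -
  have "real_of_int \<lceil>real K / real q\<rceil> \<le> 3 * real K / real q"
  proof (cases "q \<le> K")
    case True
    have "real_of_int \<lceil>real K / real q\<rceil> \<le> real K / real q + 1" by linarith
    also have "1 \<le> real K / real q" using True q by simp
    finally have "real_of_int \<lceil>real K / real q\<rceil> \<le> 2 * (real K / real q)" by simp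
    also have "\<dots> \<le> 3 * real K / real q" by (simp add: divide_right_mono)
    finally show ?thesis .
  next
    case False
    have "real_of_int \<lceil>real K / real q\<rceil> \<le> 1" using False q by (simp add: ceiling_le_iff)
    also have "1 \<le> 3 * real K / real q"
    proof -
      have "real q \<le> real (3 * K)" using q(2) by (rule of_nat_mono)
      then show ?thesis using q(1) by simp
    qed
    finally show ?thesis .
  qed
  moreover have "real m1 \<le> real q ^ 3"
    using of_nat_mono[OF m1, where 'a=real] by simp
  ultimately have "real_of_int \<lceil>real K / real q\<rceil> * real m1 \<le> 3 * real K / real q * real q ^ 3"
    by (intro mult_mono) auto
  also have "\<dots> = 3 * real K * (real q)\<^sup>2" using q(1) by (simp add: power2_eq_square power3_eq_cube)
  finally show ?thesis .
qed

lemma sample_bound_order: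
  assumes "\<Delta> > 0" "L > 0" "A > 0" "\<epsilon> > 0" and \<epsilon>: "\<epsilon>\<^sup>2 \<le> \<Delta> * L" "\<epsilon>\<^sup>2 \<le> A"
  shows "4 * real_of_int \<lceil>\<Delta> * L / \<epsilon>\<^sup>2\<rceil> * (real_of_int \<lceil>(A / \<epsilon>\<^sup>2) powr (1/3)\<rceil>)\<^sup>2
    \<le> 32 * (\<Delta> * L * A powr (2/3) / \<epsilon> powr (10/3))"
proof -
  have ceil: "real_of_int \<lceil>t\<rceil> \<le> 2 * t" if "1 \<le> t" for t :: real using that by linarith
  let ?u = "\<Delta> * L / \<epsilon>\<^sup>2" and ?a = "(A / \<epsilon>\<^sup>2) powr (1/3)"
  have u: "1 \<le> ?u" using assms by simp
  have a: "1 \<le> ?a" using assms by (intro ge_one_powr_ge_zero) auto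
  have "4 * real_of_int \<lceil>?u\<rceil> * (real_of_int \<lceil>?a\<rceil>)\<^sup>2 \<le> 4 * (2 * ?u) * (2 * ?a)\<^sup>2"
    using ceil[OF u] ceil[OF a] u a by (intro mult_mono power_mono) (auto intro: order_trans)
  also have "?a\<^sup>2 = A powr (2/3) / \<epsilon> powr (4/3)"
  proof -
    have "\<epsilon>\<^sup>2 powr (2/3) = \<epsilon> powr (4/3)"
      using assms by (simp add: powr_powr flip: powr_numeral)
    moreover have "?a\<^sup>2 = (A / \<epsilon>\<^sup>2) powr (2/3)"
      using assms by (subst powr_realpow[symmetric]) (simp_all only: powr_powr, simp_all)
    ultimately show ?thesis using assms by (simp add: powr_divide)
  qed
  then have "4 * (2 * ?u) * (2 * ?a)\<^sup>2 = 32 * (\<Delta> * L * A powr (2/3) / (\<epsilon>\<^sup>2 * \<epsilon> powr (4/3)))"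
    by (simp add: power_mult_distrib)
  also have "\<epsilon>\<^sup>2 * \<epsilon> powr (4/3) = \<epsilon> powr (10/3)"
    using assms by (simp flip: powr_add powr_numeral)
  finally show ?thesis .
qed

text \<open>As the accuracy tends to zero, \<open>q\<close> grows like its power \<open>-2/3\<close> and \<open>K\<close> like its power \<open>-2\<close>.\<close>

lemma eventually_small_accuracy:
  assumes "\<Delta> > 0" "L > 0" "A > 0"
  shows "\<forall>\<^sub>F e in at_right 0. q_choice A e \<le> 3 * K_choice \<Delta> L e \<and> e\<^sup>2 \<le> \<Delta> * L \<and> e\<^sup>2 \<le> A"
proof -
  have DL: "\<Delta> * L > 0" using assms by simp
  have ceil: "real (nat \<lceil>t\<rceil>) \<le> t + 1" if "0 \<le> t" for t :: real using that by linarith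
  have 1: "\<forall>\<^sub>F e in at_right 0. e\<^sup>2 \<le> B" if "B > 0" for B :: real
    using that by real_asymp
  have "\<forall>\<^sub>F e in at_right 0. (A / e\<^sup>2) powr (1/3) + 1 \<le> 3 * (B / e\<^sup>2)" if "B > 0" for B :: real
    using that assms(3) by real_asymp
  from this[OF DL] have 2: "\<forall>\<^sub>F e in at_right 0. q_choice A e \<le> 3 * K_choice \<Delta> L e"
  proof eventually_elim
    case (elim e)
    have "real (q_choice A e) \<le> (A / e\<^sup>2) powr (1/3) + 1"
      unfolding q_choice_def by (rule ceil) simp
    also have "\<dots> \<le> 3 * (\<Delta> * L / e\<^sup>2)" by (rule elim)
    also have "\<dots> \<le> 3 * real (K_choice \<Delta> L e)"
      unfolding K_choice_def by (intro mult_left_mono real_nat_ceiling_ge) simp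
    finally have "real (q_choice A e) \<le> real (3 * K_choice \<Delta> L e)" by simp
    then show ?case by (simp only: of_nat_le_iff)
  qed
  show ?thesis using 1[OF DL] 1[OF assms(3)] 2 by eventually_elim simp
qed
section \<open>Accuracy and sample complexity of the chosen parameters\<close>

theorem corollary2:
  fixes D :: "'z measure" and M :: "'w measure"
    and F :: "real ^ 'd \<Rightarrow> 'z \<Rightarrow> real" and X :: "(real ^ 'd) set"
    and L \<sigma> f_low \<Delta> c A \<epsilon> \<eta> \<epsilon>h \<rho> :: real
    and K q m m1 :: nat
    and \<zeta> :: "nat \<Rightarrow> nat \<Rightarrow> 'w \<Rightarrow> 'z"
    and x G :: "nat \<Rightarrow> 'w \<Rightarrow> real ^ 'd"
    and Y :: "'w \<Rightarrow> nat"
  assumes dim: "CARD('d) \<ge> 2"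
    and c: "c > 0" "averaging_constant TYPE('w) TYPE('d) c"
    and \<epsilon>_pos: "\<epsilon> > 0"
    and \<Delta>: "\<Delta> = (\<integral>\<omega>. objective D F (x 1 \<omega>) \<partial>M) - f_low" "\<Delta> > 0"
    and A: "A = c * ln (real CARD('d)) * \<sigma>\<^sup>2"
    and \<eta>: "\<eta> = 1 / L"
    and K: "K = K_choice \<Delta> L \<epsilon>"
    and m1: "m1 = m1_choice A \<epsilon>"
    and q: "q = q_choice A \<epsilon>"
    and m: "m = q\<^sup>2"
    and \<epsilon>h: "\<epsilon>h = \<epsilon> / L"
    and \<rho>: "\<rho> = 128"
    and run: "disfom_vr_run D F X L \<sigma> f_low M (dist_term \<rho>) \<eta> \<epsilon>h K q m m1 \<zeta> x G Y"
  shows "(integrable M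
           (\<lambda>\<omega>. dist_inf_zero (constrained_subdiff (objective D F) X (x (Y \<omega> + 1) \<omega>)))) \<and>
     ((\<integral>\<omega>. dist_inf_zero (constrained_subdiff (objective D F) X (x (Y \<omega> + 1) \<omega>)) \<partial>M)
           \<le> C_err * \<epsilon>) \<and>
     (real (card (sample_index K q m m1))
           \<le> real K * real m + real_of_int \<lceil>real K / real q\<rceil> * real m1) \<and>
     (q \<le> 3 * K \<longrightarrow>
           real K * real m + real_of_int \<lceil>real K / real q\<rceil> * real m1
             \<le> 2 * real K * (real m + (real q)\<^sup>2)) \<and>
     (2 * real K * (real m + (real q)\<^sup>2)
           = 4 * real_of_int \<lceil>\<Delta> * L / \<epsilon>\<^sup>2\<rceil> * (real_of_int \<lceil>(A / \<epsilon>\<^sup>2) powr (1/3)\<rceil>)\<^sup>2) \<and>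
     (\<epsilon>\<^sup>2 \<le> \<Delta> * L \<and> \<epsilon>\<^sup>2 \<le> A \<longrightarrow>
           4 * real_of_int \<lceil>\<Delta> * L / \<epsilon>\<^sup>2\<rceil> * (real_of_int \<lceil>(A / \<epsilon>\<^sup>2) powr (1/3)\<rceil>)\<^sup>2
             \<le> C_cost * (\<Delta> * L * A powr (2/3) / \<epsilon> powr (10/3))) \<and>
     (\<forall>\<^sub>F e in at_right 0.
           q_choice A e \<le> 3 * K_choice \<Delta> L e \<and> e\<^sup>2 \<le> \<Delta> * L \<and> e\<^sup>2 \<le> A)"
proof -
  have "disfom_vr_run D F X L \<sigma> f_low M (dist_term 128) (1 / L) \<epsilon>h K q m m1 \<zeta> x G Y"
    using run by (simp only: \<eta> \<rho>)
  then interpret disfom_l1_run D F X L \<sigma> f_low M \<epsilon>h K q m m1 \<zeta> x G Y c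
    by (intro disfom_l1_run.intro disfom_l1_run_axioms.intro c(2))
  have A0: "A > 0" using c(1) \<sigma>_pos dim by (simp add: A)
  have q1: "q \<ge> 1" by (rule params_pos)
  have m1A: "A / \<epsilon>\<^sup>2 \<le> real m1" unfolding m1 m1_choice_def by (rule real_nat_ceiling_ge)
  have KD: "\<Delta> * L / \<epsilon>\<^sup>2 \<le> real K" unfolding K K_choice_def by (rule real_nat_ceiling_ge)
  have m1_bound: "c * ln (real CARD('d)) * \<sigma>\<^sup>2 / real m1 \<le> \<epsilon>\<^sup>2"
  proof -
    have "A / real m1 \<le> \<epsilon>\<^sup>2" using m1A \<epsilon>_pos params_pos(4) by (simp add: field_simps)
    then show ?thesis unfolding A .
  qed
  have K_bound: "((\<integral>\<omega>. f (x 1 \<omega>) \<partial>M) - f_low) * L \<le> real K * \<epsilon>\<^sup>2"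
    using KD \<epsilon>_pos unfolding \<Delta>(1)[symmetric] by (simp add: field_simps)
  note stat = expected_stationarity[OF \<epsilon>_pos \<epsilon>h m1_bound m K_bound]
  have cost: "real K * real m + real_of_int \<lceil>real K / real q\<rceil> * real m1 \<le> 2 * real K * (real m + (real q)\<^sup>2)"
    if "q \<le> 3 * K"
  proof -
    have "m1 \<le> q ^ 3" unfolding m1 q by (rule m1_choice_le_q_choice_cubed[OF A0 \<epsilon>_pos])
    from sample_bound_simplified[OF q1 that this] show ?thesis by (simp add: m algebra_simps)
  qed
  have closed_form: "2 * real K * (real m + (real q)\<^sup>2)
      = 4 * real_of_int \<lceil>\<Delta> * L / \<epsilon>\<^sup>2\<rceil> * (real_of_int \<lceil>(A / \<epsilon>\<^sup>2) powr (1/3)\<rceil>)\<^sup>2"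
  proof -
    have "0 \<le> \<lceil>\<Delta> * L / \<epsilon>\<^sup>2\<rceil>" "0 \<le> \<lceil>(A / \<epsilon>\<^sup>2) powr (1/3)\<rceil>"
      using \<Delta>(2) L_pos by (auto simp: zero_le_ceiling intro: less_le_trans[of _ 0])
    then show ?thesis by (simp add: m K q K_choice_def q_choice_def)
  qed
  show ?thesis
    using stat card_sample_index_le[OF q1] cost closed_form
      sample_bound_order[OF \<Delta>(2) L_pos A0 \<epsilon>_pos] eventually_small_accuracy[OF \<Delta>(2) L_pos A0]
    unfolding C_err_def C_cost_def by blast
qed

end
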